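(* In the setting of the context, let $(\underline\rho^n_{\mathcal{D}}\in\underline V^\omega_{\mathcal{D},0})_{n\ge1}$ be the solution to the exponential fitting evolution scheme and $\underline\rho^\infty_{\mathcal{D}}\in\underline V^\omega_{\mathcal{D},0}$ the solution to the corresponding stationary scheme. Set $u^n_K=\omega_K\rho^n_K$, $u^n_\sigma=\omega_\sigma\rho^n_\sigma$ and $u^\infty_K=\omega_K\rho^\infty_K$, $u^\infty_\sigma=\omega_\sigma\rho^\infty_\sigma$ (and $u^0_K=\omega_K\rho_K^0$), and $$\mathbb{E}^n_\omega=\tfrac12\|\rho^n_{\mathcal{M}}-\rho^\infty_{\mathcal{M}}\|^2_{L^2_\omega(\Omega)}\ (n\ge0),\qquad\mathbb{D}^n_\omega=a^\omega_{\mathcal{D}}(\underline\rho^n_{\mathcal{D}}-\underline\rho^\infty_{\mathcal{D}},\underline\rho^n_{\mathcal{D}}-\underline\rho^\infty_{\mathcal{D}})\ (n\ge1).$$ Then $$\forall n\in\mathbb{N},\qquad\frac{\mathbb{E}^{n+1}_\omega-\mathbb{E}^n_\omega}{\Delta t}+\mathbb{D}^{n+1}_\omega\le0.$$ Furthermore, with $\nu_\omega:=\frac{2\omega_\flat\lambda_\flat\alpha_\flat}{\omega_\sharp C_P^2}>0$, where $C_P=2C_{PW}$ if $|\Gamma^D|=0$ and $C_P=C_{P,\Gamma^D}$ otherwise, $$\forall n\in\mathbb{N},\qquad\mathbb{E}^{n+1}_\omega\le(1+\nu_\omega\Delta t)^{-1}\mathbb{E}^n_\omega.$$ Consequently, for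 all $n\ge1$, $$\|u^n_{\mathcal{M}}-u^\infty_{\mathcal{M}}\|_{L^2(\Omega)}\le\sqrt{\frac{\omega_\sharp}{\omega_\flat}}\,(1+\nu_\omega\Delta t)^{-\frac n2}\|u^0_{\mathcal{M}}-u^\infty_{\mathcal{M}}\|_{L^2(\Omega)}.$$
   Context: **Data.** $\Omega\subset\mathbb{R}^d$, $d\in\{2,3\}$, is open, bounded, connected and polytopal, $\partial\Omega=\overline{\Gamma^D}\cup\overline{\Gamma^N}$ with $\Gamma^D,\Gamma^N$ disjoint and open in $\partial\Omega$. $\Lambda\in L^\infty(\Omega;\mathbb{R}^{d\times d})$ is symmetric with, for some $0<\lambda_\flat\le\lambda_\sharp<\infty$, $\xi\cdot\Lambda(x)\xi\ge\lambda_\flat|\xi|^2$ and $|\Lambda(x)\xi|\le\lambda_\sharp|\xi|$ for a.e. $x$ and all $\xi\in\mathbb{R}^d$. $\phi\in C^1(\overline\Omega)$ with $\Lambda\nabla\phi\in H(\mathrm{div};\Omega)$; $\omega:=e^{-\phi}$, and $0<\omega_\flat\le\omega_\sharp<\infty$ (only depending on $\phi,\Omega$) are such that $\omega_\flat\le\omega\le\omega_\sharp$ on $\overline\Omega$. $L^2_\omega(\Omega)$ is the $\omega$-weighted $L^2$ space. $f\in L^2(\Omega)$, $g^N\in L^2(\Gamma^N)$, $u^{in}\in L^2(\Omega)$. When $|\Gamma^D|=0$ it is assumed that $\int_\Omega f+\int_{\partial\Omega}g^N=0$ and $\int_\Omega u^{in}=0$; when $|\Gamma^D|>0$ the Dirichlet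 datum is $0$. $\Delta t>0$ is fixed. **Discretisation.** A discretisation of $\Omega$ is a triplet $\mathcal{D}=(\mathcal{M},\mathcal{E},\mathcal{P})$. $\mathcal{M}$ is a finite family of nonempty disjoint open connected polytopal subsets $K$ of $\Omega$ (cells) with $|K|>0$ and $\overline\Omega=\bigcup_K\overline K$. $\mathcal{E}$ is a finite family of nonempty disjoint (relatively open) connected subsets $\sigma$ of $\overline\Omega$ (faces), each of positive $(d-1)$-dimensional measure $|\sigma|$ and contained in an affine hyperplane $\mathcal{H}_\sigma$, with $\bigcup_K\partial K=\bigcup_\sigma\overline\sigma$; for each $K$ there is $\mathcal{E}_K\subset\mathcal{E}$ with $\partial K=\bigcup_{\sigma\in\mathcal{E}_K}\overline\sigma$. With $\mathcal{M}_\sigma=\{K:\sigma\in\mathcal{E}_K\}$, each $\sigma$ is either a boundary face ($\mathcal{M}_\sigma=\{K\}$, $\sigma\subset\partial\Omega$) or an interface ($\mathcal{M}_\sigma=\{K,L\}$). Each boundary face is contained in $\Gamma^D$ or in $\Gamma^N$; $\mathcal{E}^D_{ext}$ is the set of those contained in $\Gamma^D$. $\mathcal{P}=\{x_K\}_{K\in\mathcal{M}}$ with $x_K\in K$, $K$ star-shaped with respect to $x_K$, and the distance $d_{K,\sigma}$ from $x_K$ to $\mathcal{H}_\sigma$ positive for all $\sigma\in\mathcal{E}_K$. $h_K$ is the diameter of $K$, $\overline{x}_\sigma$ the barycentre of $\sigma$, $n_{K,\sigma}$ the unit normal to $\sigma$ outward to $K$, $P_{K,\sigma}$ the open pyramid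 with base $\sigma$ and apex $x_K$, and $\theta_{\mathcal{D}}=\max\big(\max_{K,\sigma\in\mathcal{E}_K}\frac{h_K}{d_{K,\sigma}},\max_{\sigma,K\in\mathcal{M}_\sigma}\frac{h_K^{d-1}}{|\sigma|}\big)$. **Unknowns.** $\underline{V}_{\mathcal{D}}$ is the space of real vectors $\underline{v}_{\mathcal{D}}=((v_K)_{K\in\mathcal{M}},(v_\sigma)_{\sigma\in\mathcal{E}})$; $\underline{v}_K=(v_K,(v_\sigma)_{\sigma\in\mathcal{E}_K})$; $v_{\mathcal{M}}$ (resp. $v_{\mathcal{E}}$) is the piecewise constant function equal to $v_K$ on $K$ (resp. $v_\sigma$ on $\sigma$); $(\cdot,\cdot)_X$ is the $L^2(X)$ inner product. $\underline V^N_{\mathcal{D},0}=\{\underline v_{\mathcal{D}}:\int_\Omega v_{\mathcal{M}}=0\}$, $\underline V^D_{\mathcal{D},0}=\{\underline v_{\mathcal{D}}:v_\sigma=0\ \forall\sigma\in\mathcal{E}^D_{ext}\}$. $\underline V^\omega_{\mathcal{D},0}$ is $\underline V^D_{\mathcal{D},0}$ if $|\Gamma^D|>0$ and $\{\underline v_{\mathcal{D}}:\int_\Omega\omega v_{\mathcal{M}}=0\}$ if $|\Gamma^D|=0$. $|\underline v_{\mathcal{D}}|_{1,\mathcal{D}}^2=\sum_K\sum_{\sigma\in\mathcal{E}_K}\frac{|\sigma|}{d_{K,\sigma}}(v_K-v_\sigma)^2$. $\omega_K=\frac1{|K|}\int_K\omega$, $\omega_\sigma=\frac1{|\sigma|}\int_\sigma\omega$,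 and $\omega_{\mathcal{M}}$ is the associated piecewise constant function. **Bilinear form.** With a fixed $\eta>0$, $\nabla_K\underline v_K$ equals on $P_{K,\sigma}$ the vector $G_K\underline v_K+\frac{\eta}{d_{K,\sigma}}\big(v_\sigma-v_K-G_K\underline v_K\cdot(\overline x_\sigma-x_K)\big)n_{K,\sigma}$, where $G_K\underline v_K=\frac1{|K|}\sum_{\sigma'\in\mathcal{E}_K}|\sigma'|(v_{\sigma'}-v_K)n_{K,\sigma'}$; $a^\omega_{\mathcal{D}}(\underline\rho_{\mathcal{D}},\underline v_{\mathcal{D}})=\sum_K\int_K\omega\Lambda\nabla_K\underline\rho_K\cdot\nabla_K\underline v_K$. **Schemes.** Stationary: find $\underline\rho^\infty_{\mathcal{D}}\in\underline V^\omega_{\mathcal{D},0}$ with $a^\omega_{\mathcal{D}}(\underline\rho^\infty_{\mathcal{D}},\underline v_{\mathcal{D}})=(f,v_{\mathcal{M}})_\Omega+(g^N,v_{\mathcal{E}})_{\Gamma^N}$ for all $\underline v_{\mathcal{D}}\in\underline V^\omega_{\mathcal{D},0}$. Evolution: find $\underline\rho^n_{\mathcal{D}}\in\underline V^\omega_{\mathcal{D},0}$, $n\ge1$, with $\frac1{\Delta t}(\rho^n_{\mathcal{M}}-\rho^{n-1}_{\mathcal{M}},\omega_{\mathcal{M}}v_{\mathcal{M}})_\Omega+a^\omega_{\mathcal{D}}(\underline\rho^n_{\mathcal{D}},\underline v_{\mathcal{D}})=(f,v_{\mathcal{M}})_\Omega+(g^N,v_{\mathcal{E}})_{\Gamma^N}$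 for all $\underline v_{\mathcal{D}}\in\underline V^\omega_{\mathcal{D},0}$, and $\rho^0_K=\frac1{\omega_K|K|}\int_Ku^{in}$. Both are well-posed. **Constants.** $\alpha_\flat>0$ depends only on $\Omega,d,\theta_{\mathcal{D}}$ and is such that $\alpha_\flat\sum_{\sigma\in\mathcal{E}_K}\frac{|\sigma|}{d_{K,\sigma}}(v_K-v_\sigma)^2\le\|\nabla_K\underline v_K\|^2_{L^2(K;\mathbb{R}^d)}$ for all $K$, $\underline v_K$. $C_{PW}$ (depending only on $\Omega,d,\theta_{\mathcal{D}}$) and, when $|\Gamma^D|>0$, $C_{P,\Gamma^D}$ (depending only on $\Omega,d,\Gamma^D,\theta_{\mathcal{D}}$) are discrete Poincaré constants: $\|v_{\mathcal{M}}\|_{L^2(\Omega)}\le C_{PW}|\underline v_{\mathcal{D}}|_{1,\mathcal{D}}$ on $\underline V^N_{\mathcal{D},0}$ and $\|v_{\mathcal{M}}\|_{L^2(\Omega)}\le C_{P,\Gamma^D}|\underline v_{\mathcal{D}}|_{1,\mathcal{D}}$ on $\underline V^D_{\mathcal{D},0}$. *)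

theory Defs
  imports "HOL-Analysis.Analysis"
begin

section \<open>Hausdorff measure\<close>

text \<open>
  The constant is the volume of the \<open>k\<close>-dimensional ball of diameter \<open>1\<close>, so that the
  \<open>k\<close>-dimensional Hausdorff measure is the \<open>k\<close>-dimensional Lebesgue measure on \<open>k\<close>-dimensional
  affine subspaces. Only \<open>k > 0\<close> is meant (for \<open>k = 0\<close> the empty set would get weight \<open>1\<close>).
  The library's \<open>diameter\<close> is only meaningful on bounded sets.
\<close>

abbreviation hausdorff_weight :: "nat \<Rightarrow> 'a::metric_space set \<Rightarrow> ennreal" where
  "hausdorff_weight k U \<equiv> ennreal (unit_ball_vol (real k) * (diameter U / 2) ^ k)"

abbreviation hausdorff_covers :: "real \<Rightarrow> 'a::metric_space set \<Rightarrow> (nat \<Rightarrow> 'a set) set" where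
  "hausdorff_covers \<delta> A \<equiv>
     {U. A \<subseteq> (\<Union>i. U i) \<and> (\<forall>i. bounded (U i) \<and> diameter (U i) \<le> \<delta>)}"

definition hausdorff_pre :: "nat \<Rightarrow> real \<Rightarrow> 'a::metric_space set \<Rightarrow> ennreal" where
  "hausdorff_pre k \<delta> A = (INF U\<in>hausdorff_covers \<delta> A. \<Sum>i. hausdorff_weight k (U i))"

definition hausdorff_outer :: "nat \<Rightarrow> 'a::metric_space set \<Rightarrow> ennreal" where
  "hausdorff_outer k A = (SUP \<delta>\<in>{0<..}. hausdorff_pre k \<delta> A)"

definition hausdorff_measure :: "nat \<Rightarrow> 'a::metric_space measure" where
  "hausdorff_measure k =
     measure_of UNIV (lambda_system UNIV (Pow UNIV) (hausdorff_outer k)) (hausdorff_outer k)"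

text \<open>
  \<open>measure_of\<close> silently yields the zero measure if the set function is not a measure. The following
  lemmas exclude this for \<open>k > 0\<close> and show that all Borel sets are measurable.
\<close>

lemma hausdorff_pre_mono: "A \<subseteq> B \<Longrightarrow> hausdorff_pre k \<delta> A \<le> hausdorff_pre k \<delta> B"
  unfolding hausdorff_pre_def by (rule INF_superset_mono) auto

lemma hausdorff_pre_antimono: "\<delta> \<le> \<epsilon> \<Longrightarrow> hausdorff_pre k \<epsilon> A \<le> hausdorff_pre k \<delta> A"
  unfolding hausdorff_pre_def by (rule INF_superset_mono) (auto intro: order_trans)

lemma hausdorff_pre_empty: "0 < k \<Longrightarrow> 0 < \<delta> \<Longrightarrow> hausdorff_pre k \<delta> {} = 0"
proof -
  assume "0 < k" "0 < \<delta>"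
  then have "hausdorff_pre k \<delta> {} \<le> (\<Sum>i::nat. hausdorff_weight k {})"
    unfolding hausdorff_pre_def by (intro INF_lower2[of "\<lambda>_. {}"]) (auto simp: diameter_def)
  then show ?thesis using \<open>0 < k\<close> by (simp add: diameter_def power_0_left)
qed

lemma hausdorff_pre_UN:
  "hausdorff_pre k \<delta> (\<Union>n::nat. A n) \<le> (\<Sum>n. hausdorff_pre k \<delta> (A n))"
proof (rule ennreal_le_epsilon)
  fix e :: real
  assume fin: "(\<Sum>n. hausdorff_pre k \<delta> (A n)) < top" and e: "0 < e"
  have ex: "\<exists>U\<in>hausdorff_covers \<delta> (A n). (\<Sum>i. hausdorff_weight k (U i)) < hausdorff_pre k \<delta> (A n) + e * (1/2)^Suc n" for n
  proof -
    have "hausdorff_pre k \<delta> (A n) \<noteq> \<infinity>"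
      using ennreal_suminf_lessD[OF fin, of n] by auto
    moreover have "0 < ennreal (e * (1/2)^Suc n)"
      using e by simp
    ultimately have "hausdorff_pre k \<delta> (A n) + 0 < hausdorff_pre k \<delta> (A n) + e * (1/2)^Suc n"
      unfolding ennreal_add_left_cancel_less by blast
    then have "(INF U\<in>hausdorff_covers \<delta> (A n). \<Sum>i. hausdorff_weight k (U i))
        < hausdorff_pre k \<delta> (A n) + e * (1/2)^Suc n"
      unfolding hausdorff_pre_def[of k \<delta> "A n", symmetric] by (simp only: add_0_right)
    then show ?thesis
      unfolding INF_less_iff .
  qed
  have "\<forall>n. \<exists>U. U \<in> hausdorff_covers \<delta> (A n) \<and>
      (\<Sum>i. hausdorff_weight k (U i)) < hausdorff_pre k \<delta> (A n) + e * (1/2)^Suc n"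
    using ex unfolding Bex_def by (rule allI)
  from choice[OF this] obtain U where U: "\<And>n. U n \<in> hausdorff_covers \<delta> (A n)"
    "\<And>n. (\<Sum>i. hausdorff_weight k (U n i)) < hausdorff_pre k \<delta> (A n) + e * (1/2)^Suc n"
    by (elim exE) blast
  have "hausdorff_pre k \<delta> (\<Union>n. A n) \<le> (\<Sum>m. hausdorff_weight k ((\<lambda>(n,i). U n i) (prod_decode m)))"
    unfolding hausdorff_pre_def
  proof (rule INF_lower, safe)
    fix x n assume "x \<in> A n"
    then obtain i where "x \<in> U n i" using U(1)[of n] by blast
    then show "x \<in> (\<Union>m. (\<lambda>(n,i). U n i) (prod_decode m))"
      by (intro UN_I[of "prod_encode (n,i)"]) auto
  next
    fix m show "bounded ((\<lambda>(n,i). U n i) (prod_decode m))" "diameter ((\<lambda>(n,i). U n i) (prod_decode m)) \<le> \<delta>"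
      using U(1) by (auto split: prod.split)
  qed
  also have "\<dots> = (\<Sum>n. \<Sum>i. hausdorff_weight k (U n i))"
    by (rule suminf_ennreal_2dimen[where f="\<lambda>p. hausdorff_weight k ((\<lambda>(n,i). U n i) p)"]) simp
  also have "\<dots> \<le> (\<Sum>n. hausdorff_pre k \<delta> (A n) + e * (1/2)^Suc n)"
    using U(2) by (intro suminf_le) (auto intro: less_imp_le)
  also have "\<dots> = (\<Sum>n. hausdorff_pre k \<delta> (A n)) + (\<Sum>n. ennreal (e * (1/2)^Suc n))"
    by (rule suminf_add[symmetric]) auto
  also have "(\<Sum>n. ennreal (e * (1/2)^Suc n)) = ennreal e"
    using e sums_mult[OF power_half_series, of e]
    by (intro suminf_ennreal_eq) (simp_all del: power_Suc)
  finally show "hausdorff_pre k \<delta> (\<Union>n. A n) \<le> (\<Sum>n. hausdorff_pre k \<delta> (A n)) + ennreal e" .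
qed

lemma hausdorff_outer_mono: "A \<subseteq> B \<Longrightarrow> hausdorff_outer k A \<le> hausdorff_outer k B"
  unfolding hausdorff_outer_def by (rule SUP_mono) (auto intro: hausdorff_pre_mono)

lemma hausdorff_outer_empty: "0 < k \<Longrightarrow> hausdorff_outer k {} = 0"
  unfolding hausdorff_outer_def by (simp add: hausdorff_pre_empty)

lemma hausdorff_outer_UN: "hausdorff_outer k (\<Union>n::nat. A n) \<le> (\<Sum>n. hausdorff_outer k (A n))"
  unfolding hausdorff_outer_def[of k "\<Union>n. A n"]
proof (rule SUP_least)
  fix \<delta> :: real assume "\<delta> \<in> {0<..}"
  then have "(\<Sum>n. hausdorff_pre k \<delta> (A n)) \<le> (\<Sum>n. hausdorff_outer k (A n))"
    unfolding hausdorff_outer_def by (intro suminf_le SUP_upper) auto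
  then show "hausdorff_pre k \<delta> (\<Union>n. A n) \<le> (\<Sum>n. hausdorff_outer k (A n))"
    using hausdorff_pre_UN order_trans by blast
qed

lemma outer_measure_space_hausdorff:
  "0 < k \<Longrightarrow> outer_measure_space (Pow UNIV) (hausdorff_outer k)"
  unfolding outer_measure_space_def positive_def increasing_def countably_subadditive_def
  by (simp add: hausdorff_outer_mono hausdorff_outer_empty hausdorff_outer_UN)

lemma measure_space_hausdorff:
  "0 < k \<Longrightarrow> measure_space UNIV (lambda_system UNIV (Pow UNIV) (hausdorff_outer k)) (hausdorff_outer k)"
  by (rule sigma_algebra.caratheodory_lemma[OF sigma_algebra_Pow outer_measure_space_hausdorff])

lemma sets_hausdorff_measure:
  "0 < k \<Longrightarrow> sets (hausdorff_measure k) = lambda_system UNIV (Pow UNIV) (hausdorff_outer k)"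
  unfolding hausdorff_measure_def
  using measure_space_hausdorff[of k]
  by (subst sets_measure_of) (auto simp: measure_space_def intro!: sigma_algebra.sigma_sets_eq)

lemma emeasure_hausdorff_measure:
  assumes "0 < k" "A \<in> sets (hausdorff_measure k)"
  shows "emeasure (hausdorff_measure k) A = hausdorff_outer k A"
  unfolding hausdorff_measure_def
  using measure_space_hausdorff[OF assms(1)] assms(2)[unfolded sets_hausdorff_measure[OF assms(1)]]
  by (intro emeasure_measure_of_sigma) (auto simp: measure_space_def)

lemma hausdorff_pre_separated:
  assumes k: "0 < k" and \<delta>: "0 < \<delta>" "\<delta> < r" and sep: "\<And>x y. x \<in> A \<Longrightarrow> y \<in> B \<Longrightarrow> r \<le> dist x y"
  shows "hausdorff_pre k \<delta> A + hausdorff_pre k \<delta> B \<le> hausdorff_pre k \<delta> (A \<union> B)"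
  unfolding hausdorff_pre_def[of k \<delta> "A \<union> B"]
proof (rule INF_greatest)
  fix U assume U: "U \<in> hausdorff_covers \<delta> (A \<union> B)"
  define V where "V C i = (if U i \<inter> C = {} then {} else U i)" for C i
  have le: "hausdorff_pre k \<delta> C \<le> (\<Sum>i. hausdorff_weight k (V C i))" if "C \<subseteq> A \<union> B" for C
    unfolding hausdorff_pre_def
  proof (rule INF_lower, safe)
    fix x assume "x \<in> C"
    then have "x \<in> (\<Union>i. U i)" using U that by fast
    then obtain i where "x \<in> U i" by blast
    with \<open>x \<in> C\<close> show "x \<in> (\<Union>i. V C i)" by (auto simp: V_def)
  next
    have V: "V C i = U i \<or> V C i = {}" for i by (auto simp: V_def)
    have "bounded (U i)" "diameter (U i) \<le> \<delta>" for i using U by auto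
    then show "bounded (V C i)" "diameter (V C i) \<le> \<delta>" for i
      using V[of i] \<delta>(1) by (auto simp: diameter_empty)
  qed
  have "hausdorff_weight k (V A i) + hausdorff_weight k (V B i) \<le> hausdorff_weight k (U i)" for i
  proof -
    have "U i \<inter> A = {} \<or> U i \<inter> B = {}"
    proof (rule ccontr)
      assume "\<not> ?thesis"
      then obtain x y where "x \<in> U i" "y \<in> U i" "x \<in> A" "y \<in> B" by blast
      then have "r \<le> dist x y" "dist x y \<le> diameter (U i)" 
        using sep U diameter_bounded_bound[of "U i" x y] by auto
      moreover have "diameter (U i) \<le> \<delta>" using U by blast
      ultimately show False using \<delta> by linarith
    qed
    then show ?thesis using k by (auto simp: V_def power_0_left)
  qed
  then have "(\<Sum>i. hausdorff_weight k (V A i)) + (\<Sum>i. hausdorff_weight k (V B i)) \<le> (\<Sum>i. hausdorff_weight k (U i))"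
    by (subst suminf_add) (auto intro!: suminf_le)
  then show "hausdorff_pre k \<delta> A + hausdorff_pre k \<delta> B \<le> (\<Sum>i. hausdorff_weight k (U i))"
    using le[of A] le[of B] by (meson add_mono order_trans sup_ge1 sup_ge2)
qed

lemma hausdorff_outer_separated:
  assumes k: "0 < k" and r: "0 < r" and sep: "\<And>x y. x \<in> A \<Longrightarrow> y \<in> B \<Longrightarrow> r \<le> dist x y"
  shows "hausdorff_outer k A + hausdorff_outer k B \<le> hausdorff_outer k (A \<union> B)"
proof -
  have "hausdorff_outer k A + hausdorff_outer k B
      = (SUP \<delta>\<in>{0<..}. hausdorff_pre k \<delta> A + hausdorff_pre k \<delta> B)"
    unfolding hausdorff_outer_def
  proof (rule SUP_add_directed_ennreal[symmetric])
    fix s t :: real assume "s \<in> {0<..}" "t \<in> {0<..}"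
    then show "\<exists>u\<in>{0<..}. hausdorff_pre k s A + hausdorff_pre k t B \<le> hausdorff_pre k u A + hausdorff_pre k u B"
      by (intro bexI[of _ "min s t"] add_mono hausdorff_pre_antimono) auto
  qed
  also have "\<dots> \<le> hausdorff_outer k (A \<union> B)"
  proof (rule SUP_least)
    fix \<delta> :: real assume "\<delta> \<in> {0<..}"
    define u where "u = min \<delta> (r/2)"
    have u: "0 < u" "u < r" "u \<le> \<delta>" using r \<open>\<delta> \<in> _\<close> by (auto simp: u_def)
    have "hausdorff_pre k \<delta> A + hausdorff_pre k \<delta> B \<le> hausdorff_pre k u A + hausdorff_pre k u B"
      using u by (intro add_mono hausdorff_pre_antimono) auto
    also have "\<dots> \<le> hausdorff_pre k u (A \<union> B)"
      using k u(1,2) sep by (rule hausdorff_pre_separated)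
    also have "\<dots> \<le> hausdorff_outer k (A \<union> B)"
      unfolding hausdorff_outer_def using u by (intro SUP_upper) auto
    finally show "hausdorff_pre k \<delta> A + hausdorff_pre k \<delta> B \<le> hausdorff_outer k (A \<union> B)" .
  qed
  finally show ?thesis .
qed

lemma closed_in_hausdorff:
  fixes F :: "'a::metric_space set"
  assumes k: "0 < k" and F: "closed F"
  shows "F \<in> lambda_system UNIV (Pow UNIV) (hausdorff_outer k)"
proof -
  let ?H = "hausdorff_outer k :: 'a set \<Rightarrow> ennreal"
  have Un: "?H (A \<union> B) \<le> ?H A + ?H B" for A B
  proof -
    have "?H (\<Union>n. if n = 0 then A else if n = Suc 0 then B else {})
        \<le> (\<Sum>n. ?H (if n = 0 then A else if n = Suc 0 then B else {}))"
      by (rule hausdorff_outer_UN)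
    also have "(\<Union>n. if n = (0::nat) then A else if n = Suc 0 then B else {}) = A \<union> B"
      by (auto split: if_splits)
    also have "(\<Sum>n. ?H (if n = 0 then A else if n = Suc 0 then B else {})) = ?H A + ?H B"
      using hausdorff_outer_empty[OF k] by (subst suminf_finite[of "{0, Suc 0}"]) auto
    finally show ?thesis .
  qed
  have "?H (F \<inter> X) + ?H (X - F) \<le> ?H X" if ne: "F \<noteq> {}" and fin: "?H X < top" for X
  proof -
    define A where "A n = {x\<in>X. 1 / (real n + 1) \<le> infdist x F}" for n
    define R where "R n = A (Suc n) - A n" for n
    have A_mono: "A m \<subseteq> A n" if "m \<le> n" for m n
    proof -
      have "1 / (real n + 1) \<le> 1 / (real m + 1)" using that by (intro divide_left_mono) auto
      then show ?thesis by (auto simp: A_def)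
    qed
    have X_F: "X - F = (\<Union>n. A n)"
    proof -
      have "(\<exists>n. 1 / (real n + 1) \<le> infdist x F) \<longleftrightarrow> x \<notin> F" for x
      proof
        assume "\<exists>n. 1 / (real n + 1) \<le> infdist x F"
        then obtain n where n: "1 / (real n + 1) \<le> infdist x F" ..
        moreover have "0 < 1 / (real n + 1)" by simp
        ultimately have "infdist x F \<noteq> 0" by linarith
        then show "x \<notin> F" by auto
      next
        assume "x \<notin> F"
        then have "0 < infdist x F" 
          using in_closed_iff_infdist_zero[OF F ne] infdist_nonneg[of x F] by (metis order_le_less)
        then show "\<exists>n. 1 / (real n + 1) \<le> infdist x F"
          using reals_Archimedean[of "infdist x F"] by (auto simp: inverse_eq_divide add.commute intro: less_imp_le)
      qed
      then show ?thesis by (auto simp: A_def)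
    qed
    have far: "1 / (real m + 2) - 1 / (real m + 3) \<le> dist x y"
      if "x \<in> R j" "y \<in> R i" "j \<le> m" "m + 2 \<le> i" for x y m i j
    proof -
      have "x \<in> A (Suc m)" using that A_mono[of "Suc j" "Suc m"] by (auto simp: R_def)
      then have "1 / (real m + 2) \<le> infdist x F" by (auto simp: A_def add.commute)
      moreover have "y \<in> X" "y \<notin> A (m + 2)" 
        using that A_mono[of "m + 2" i] by (auto simp: R_def A_def)
      then have "infdist y F < 1 / (real m + 3)" by (auto simp: A_def add.commute)
      ultimately show ?thesis using infdist_triangle_abs[of x F y] by linarith
    qed
    have gap: "0 < 1 / (real m + 2) - 1 / (real m + 3)" for m
      by (simp add: frac_less2)
    have alt: "(\<Sum>i<N. ?H (R (2 * i + p))) \<le> ?H (\<Union>i<N. R (2 * i + p))" for N p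
    proof (induction N)
      case (Suc N)
      show ?case
      proof (cases N)
        case (Suc N')
        have "?H (\<Union>i<N. R (2 * i + p)) + ?H (R (2 * N + p)) \<le> ?H ((\<Union>i<N. R (2 * i + p)) \<union> R (2 * N + p))"
        proof (rule hausdorff_outer_separated[OF k gap[of "2 * N' + p"]])
          fix x y assume "x \<in> (\<Union>i<N. R (2 * i + p))" and y: "y \<in> R (2 * N + p)"
          then obtain i where "i < N" "x \<in> R (2 * i + p)" by blast
          with y Suc show "1 / (real (2 * N' + p) + 2) - 1 / (real (2 * N' + p) + 3) \<le> dist x y"
            by (intro far) auto
        qed
        also have "(\<Union>i<N. R (2 * i + p)) \<union> R (2 * N + p) = (\<Union>i<Suc N. R (2 * i + p))"
          by (auto simp: lessThan_Suc)
        finally show ?thesis using Suc.IH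
          by (simp add: add_right_mono order_trans[rotated])
      qed (simp add: lessThan_Suc)
    qed simp
    have R_X: "?H (\<Union>i<N. R (2 * i + p)) \<le> ?H X" for N p
      by (rule hausdorff_outer_mono) (auto simp: R_def A_def)
    have "(\<Sum>m<N. ?H (R m)) \<le> ?H X + ?H X" for N
    proof -
      have "(\<Sum>m<N. ?H (R m)) \<le> (\<Sum>m<2*N. ?H (R m))"
        by (rule sum_mono2) auto
      also have "\<dots> = (\<Sum>i<N. ?H (R (2 * i + 0))) + (\<Sum>i<N. ?H (R (2 * i + 1)))"
        by (induction N) (auto simp: algebra_simps)
      also have "\<dots> \<le> ?H X + ?H X"
        by (intro add_mono order_trans[OF alt R_X])
      finally show ?thesis .
    qed
    then have "(\<Sum>m. ?H (R m)) \<le> ?H X + ?H X"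
      by (intro suminf_le_const) auto
    also have "\<dots> < top" using fin by simp
    finally have S: "(\<Sum>m. ?H (R m)) < top" .
    have "?H (X - F) + (\<Sum>m<n. ?H (R m)) \<le> (SUP n. ?H (A n)) + (\<Sum>m. ?H (R m))" for n
    proof -
      have "X - F \<subseteq> A n \<union> (\<Union>m. R (m + n))"
      proof
        fix x assume "x \<in> X - F"
        then obtain i where "x \<in> A i" using X_F by blast
        define l where "l = (LEAST i. x \<in> A i)"
        have l: "x \<in> A l" "\<And>j. j < l \<Longrightarrow> x \<notin> A j"
          unfolding l_def using \<open>x \<in> A i\<close> by (auto intro: LeastI dest: not_less_Least)
        show "x \<in> A n \<union> (\<Union>m. R (m + n))"
        proof (cases "l \<le> n")
          case True then show ?thesis using l(1) A_mono by blast
        next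
          case False
          then obtain m where "l = Suc (m + n)" 
            by (metis add.commute less_imp_Suc_add not_le)
          then have "x \<in> R (m + n)" using l by (auto simp: R_def)
          then show ?thesis by blast
        qed
      qed
      then have "?H (X - F) \<le> ?H (A n \<union> (\<Union>m. R (m + n)))" by (rule hausdorff_outer_mono)
      also have "\<dots> \<le> ?H (A n) + ?H (\<Union>m. R (m + n))" by (rule Un)
      also have "\<dots> \<le> (SUP n. ?H (A n)) + (\<Sum>m. ?H (R (m + n)))"
        by (intro add_mono SUP_upper hausdorff_outer_UN) auto
      finally have "?H (X - F) + (\<Sum>m<n. ?H (R m)) \<le> (SUP n. ?H (A n)) + (\<Sum>m. ?H (R (m + n))) + (\<Sum>m<n. ?H (R m))"
        by (rule add_right_mono)
      then show ?thesis
        using suminf_offset[of "\<lambda>m. ?H (R m)" n] by (simp add: add.assoc)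
    qed
    then have "(SUP n. ?H (X - F) + (\<Sum>m<n. ?H (R m))) \<le> (SUP n. ?H (A n)) + (\<Sum>m. ?H (R m))"
      by (rule SUP_least)
    then have "(\<Sum>m. ?H (R m)) + ?H (X - F) \<le> (\<Sum>m. ?H (R m)) + (SUP n. ?H (A n))"
      by (simp add: ennreal_SUP_add_right[symmetric] suminf_eq_SUP add.commute)
    then have "?H (X - F) \<le> (SUP n. ?H (A n))"
      using S unfolding ennreal_add_left_cancel_le by auto
    then have "?H (F \<inter> X) + ?H (X - F) \<le> ?H (F \<inter> X) + (SUP n. ?H (A n))"
      by (rule add_left_mono)
    also have "\<dots> = (SUP n. ?H (F \<inter> X) + ?H (A n))"
      by (rule ennreal_SUP_add_right) auto
    also have "\<dots> \<le> ?H X"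
    proof (rule SUP_least)
      fix n
      have "?H (F \<inter> X) + ?H (A n) \<le> ?H ((F \<inter> X) \<union> A n)"
      proof (rule hausdorff_outer_separated[OF k])
        show "0 < 1 / (real n + 1)" by simp
        fix x y assume "x \<in> F \<inter> X" "y \<in> A n"
        then show "1 / (real n + 1) \<le> dist x y"
          using infdist_le[of x F y] by (auto simp: A_def dist_commute intro: order_trans)
      qed
      also have "\<dots> \<le> ?H X" by (rule hausdorff_outer_mono) (auto simp: A_def)
      finally show "?H (F \<inter> X) + ?H (A n) \<le> ?H X" .
    qed
    finally show ?thesis .
  qed
  then have le: "?H (F \<inter> X) + ?H (X - F) \<le> ?H X" for X
    using hausdorff_outer_empty[OF k] by (cases "F = {} \<or> ?H X = top") (auto simp: less_top)
  have "?H X \<le> ?H (F \<inter> X) + ?H (X - F)" for X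
  proof -
    have "F \<inter> X \<union> (X - F) = X" by blast
    then show ?thesis using Un[of "F \<inter> X" "X - F"] by simp
  qed
  with le have "?H (F \<inter> X) + ?H (X - F) = ?H X" for X
    by (simp add: antisym)
  moreover have "(UNIV - F) \<inter> X = X - F" for X by blast
  ultimately have "?H (F \<inter> X) + ?H ((UNIV - F) \<inter> X) = ?H X" for X
    by simp
  then show ?thesis by (simp add: lambda_system_def)
qed

lemma borel_subset_hausdorff_measure:
  assumes "0 < k"
  shows "sets borel \<subseteq> sets (hausdorff_measure k)"
proof -
  have "sigma_sets UNIV {F. closed F} \<subseteq> sets (hausdorff_measure k)"
    using closed_in_hausdorff[OF assms] sets_hausdorff_measure[OF assms]
    using sets.sigma_sets_subset[of "{F. closed F}" "hausdorff_measure k"]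
    by (auto simp: hausdorff_measure_def)
  then show ?thesis by (simp add: borel_eq_closed)
qed

definition surface :: "(real^'d) measure" where
  "surface = hausdorff_measure (CARD('d) - 1)"

section \<open>Function spaces\<close>

definition L2 :: "'a measure \<Rightarrow> ('a \<Rightarrow> 'b::real_normed_vector) \<Rightarrow> bool" where
  "L2 M f \<longleftrightarrow> f \<in> borel_measurable M \<and> integrable M (\<lambda>x. (norm (f x))\<^sup>2)"

definition L2_inner :: "'a measure \<Rightarrow> ('a \<Rightarrow> real) \<Rightarrow> ('a \<Rightarrow> real) \<Rightarrow> real" where
  "L2_inner M f g = (LINT x|M. f x * g x)"

definition L2_norm :: "'a measure \<Rightarrow> ('a \<Rightarrow> 'b::real_normed_vector) \<Rightarrow> real" where
  "L2_norm M f = sqrt (LINT x|M. (norm (f x))\<^sup>2)"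

definition weighted :: "(real^'d) set \<Rightarrow> (real^'d \<Rightarrow> real) \<Rightarrow> (real^'d) measure" where
  "weighted \<Omega> \<omega> = density (lebesgue_on \<Omega>) (\<lambda>x. ennreal (\<omega> x))"

definition Linf :: "'a measure \<Rightarrow> ('a \<Rightarrow> 'b::real_normed_vector) \<Rightarrow> bool" where
  "Linf M f \<longleftrightarrow> f \<in> borel_measurable M \<and> (\<exists>B. AE x in M. norm (f x) \<le> B)"

definition gradient :: "('a::real_inner \<Rightarrow> real) \<Rightarrow> 'a \<Rightarrow> 'a" where
  "gradient f x = (THE D. GDERIV f x :> D)"

definition C1_closure :: "'a::real_inner set \<Rightarrow> ('a \<Rightarrow> real) \<Rightarrow> bool" where
  "C1_closure \<Omega> f \<longleftrightarrow> continuous_on (closure \<Omega>) f \<and>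
     (\<exists>G. continuous_on (closure \<Omega>) G \<and> (\<forall>x\<in>\<Omega>. GDERIV f x :> G x))"

primrec Ck :: "nat \<Rightarrow> (real^'d \<Rightarrow> real) \<Rightarrow> bool" where
  "Ck 0 f \<longleftrightarrow> continuous_on UNIV f"
| "Ck (Suc k) f \<longleftrightarrow> (\<exists>G. (\<forall>x. GDERIV f x :> G x) \<and> (\<forall>i. Ck k (\<lambda>x. G x $ i)))"

definition test_function :: "(real^'d) set \<Rightarrow> (real^'d \<Rightarrow> real) \<Rightarrow> bool" where
  "test_function \<Omega> \<psi> \<longleftrightarrow> (\<forall>k. Ck k \<psi>) \<and>
     compact (closure {x. \<psi> x \<noteq> 0}) \<and> closure {x. \<psi> x \<noteq> 0} \<subseteq> \<Omega>"

definition Hdiv :: "(real^'d) set \<Rightarrow> (real^'d \<Rightarrow> real^'d) \<Rightarrow> bool" where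
  "Hdiv \<Omega> F \<longleftrightarrow> L2 (lebesgue_on \<Omega>) F \<and>
     (\<exists>q. L2 (lebesgue_on \<Omega>) q \<and>
       (\<forall>\<psi>. test_function \<Omega> \<psi> \<longrightarrow>
          (LINT x|lebesgue_on \<Omega>. F x \<bullet> gradient \<psi> x) = - (LINT x|lebesgue_on \<Omega>. q x * \<psi> x)))"

section \<open>Discretisations\<close>

definition polytopal :: "'a::euclidean_space set \<Rightarrow> bool" where
  "polytopal S \<longleftrightarrow> (\<exists>F. finite F \<and> (\<forall>P\<in>F. polytope P) \<and> S = interior (\<Union>F))"

record ('d::finite) mesh =
  cells :: "(real^'d) set set"
  faces :: "(real^'d) set set"
  faces_of :: "(real^'d) set \<Rightarrow> (real^'d) set set"
  centre :: "(real^'d) set \<Rightarrow> real^'d"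

definition cells_of :: "'d::finite mesh \<Rightarrow> (real^'d) set \<Rightarrow> (real^'d) set set" where
  "cells_of D \<sigma> = {K \<in> cells D. \<sigma> \<in> faces_of D K}"

definition boundary_face :: "(real^'d) set \<Rightarrow> 'd::finite mesh \<Rightarrow> (real^'d) set \<Rightarrow> bool" where
  "boundary_face \<Omega> D \<sigma> \<longleftrightarrow> \<sigma> \<in> faces D \<and> (\<exists>K. cells_of D \<sigma> = {K}) \<and> \<sigma> \<subseteq> frontier \<Omega>"

definition interface :: "'d::finite mesh \<Rightarrow> (real^'d) set \<Rightarrow> bool" where
  "interface D \<sigma> \<longleftrightarrow> \<sigma> \<in> faces D \<and> (\<exists>K L. K \<noteq> L \<and> cells_of D \<sigma> = {K, L})"

definition vol :: "(real^'d) set \<Rightarrow> real" where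
  "vol K = measure lebesgue K"

definition area :: "(real^'d) set \<Rightarrow> real" where
  "area \<sigma> = measure surface \<sigma>"

text \<open>A face has positive area and lies in a hyperplane, which is thus its affine hull.\<close>

definition dist_face :: "'d::finite mesh \<Rightarrow> (real^'d) set \<Rightarrow> (real^'d) set \<Rightarrow> real" where
  "dist_face D K \<sigma> = infdist (centre D K) (affine hull \<sigma>)"

definition discretisation ::
  "(real^'d) set \<Rightarrow> (real^'d) set \<Rightarrow> (real^'d) set \<Rightarrow> 'd::finite mesh \<Rightarrow> bool" where
  "discretisation \<Omega> \<Gamma>D \<Gamma>N D \<longleftrightarrow>
     finite (cells D) \<and> pairwise disjnt (cells D) \<and>
     (\<forall>K\<in>cells D. K \<noteq> {} \<and> open K \<and> connected K \<and> polytopal K \<and> K \<subseteq> \<Omega> \<and> 0 < vol K) \<and>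
     closure \<Omega> = (\<Union>K\<in>cells D. closure K) \<and>
     finite (faces D) \<and> pairwise disjnt (faces D) \<and>
     (\<forall>\<sigma>\<in>faces D. \<sigma> \<noteq> {} \<and> connected \<sigma> \<and> \<sigma> \<subseteq> closure \<Omega> \<and> 0 < area \<sigma> \<and>
        (\<exists>a b. a \<noteq> 0 \<and> \<sigma> \<subseteq> {x. a \<bullet> x = b}) \<and>
        openin (top_of_set (affine hull \<sigma>)) \<sigma>) \<and>
     (\<Union>K\<in>cells D. frontier K) = (\<Union>\<sigma>\<in>faces D. closure \<sigma>) \<and>
     (\<forall>K\<in>cells D. faces_of D K \<subseteq> faces D \<and> frontier K = (\<Union>\<sigma>\<in>faces_of D K. closure \<sigma>)) \<and>
     (\<forall>\<sigma>\<in>faces D. boundary_face \<Omega> D \<sigma> \<or> interface D \<sigma>) \<and>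
     (\<forall>\<sigma>. boundary_face \<Omega> D \<sigma> \<longrightarrow> \<sigma> \<subseteq> \<Gamma>D \<or> \<sigma> \<subseteq> \<Gamma>N) \<and>
     (\<forall>K\<in>cells D. centre D K \<in> K \<and> (\<forall>x\<in>K. closed_segment (centre D K) x \<subseteq> K) \<and>
        (\<forall>\<sigma>\<in>faces_of D K. 0 < dist_face D K \<sigma>))"

definition dirichlet_faces ::
  "(real^'d) set \<Rightarrow> (real^'d) set \<Rightarrow> 'd::finite mesh \<Rightarrow> (real^'d) set set" where
  "dirichlet_faces \<Omega> \<Gamma>D D = {\<sigma>. boundary_face \<Omega> D \<sigma> \<and> \<sigma> \<subseteq> \<Gamma>D}"

definition barycentre :: "(real^'d) set \<Rightarrow> real^'d" where
  "barycentre \<sigma> = (1 / area \<sigma>) *\<^sub>R (LINT x|restrict_space surface \<sigma>. x)"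

definition outer_normal :: "(real^'d) set \<Rightarrow> (real^'d) set \<Rightarrow> real^'d" where
  "outer_normal K \<sigma> = (THE n. norm n = 1 \<and> (\<forall>x\<in>\<sigma>. \<forall>y\<in>\<sigma>. n \<bullet> (x - y) = 0) \<and>
     (\<forall>x\<in>\<sigma>. \<exists>\<epsilon>>0. \<forall>t. 0 < t \<and> t < \<epsilon> \<longrightarrow> x - t *\<^sub>R n \<in> K \<and> x + t *\<^sub>R n \<notin> K))"

definition pyramid :: "'d::finite mesh \<Rightarrow> (real^'d) set \<Rightarrow> (real^'d) set \<Rightarrow> (real^'d) set" where
  "pyramid D K \<sigma> = (\<Union>y\<in>\<sigma>. open_segment (centre D K) y)"

definition theta :: "'d::finite mesh \<Rightarrow> real" where
  "theta D = max
     (Max {diameter K / dist_face D K \<sigma> | K \<sigma>. K \<in> cells D \<and> \<sigma> \<in> faces_of D K})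
     (Max {diameter K ^ (CARD('d) - 1) / area \<sigma> | \<sigma> K. \<sigma> \<in> faces D \<and> K \<in> cells_of D \<sigma>})"

section \<open>Discrete unknowns\<close>

text \<open>
  A vector of unknowns is a pair (cell values, face values); only the values at the cells and faces
  of the mesh are ever used.
\<close>

type_synonym 'd dofs = "((real^'d) set \<Rightarrow> real) \<times> ((real^'d) set \<Rightarrow> real)"

definition cell_fun :: "'d::finite mesh \<Rightarrow> 'd dofs \<Rightarrow> real^'d \<Rightarrow> real" where
  "cell_fun D v x = (\<Sum>K\<in>cells D. fst v K * indicator K x)"

definition face_fun :: "'d::finite mesh \<Rightarrow> 'd dofs \<Rightarrow> real^'d \<Rightarrow> real" where
  "face_fun D v x = (\<Sum>\<sigma>\<in>faces D. snd v \<sigma> * indicator \<sigma> x)"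

definition V_neumann :: "(real^'d) set \<Rightarrow> 'd::finite mesh \<Rightarrow> 'd dofs set" where
  "V_neumann \<Omega> D = {v. (LINT x|lebesgue_on \<Omega>. cell_fun D v x) = 0}"

definition V_dirichlet :: "(real^'d) set \<Rightarrow> (real^'d) set \<Rightarrow> 'd::finite mesh \<Rightarrow> 'd dofs set" where
  "V_dirichlet \<Omega> \<Gamma>D D = {v. \<forall>\<sigma>\<in>dirichlet_faces \<Omega> \<Gamma>D D. snd v \<sigma> = 0}"

definition V_omega ::
  "(real^'d) set \<Rightarrow> (real^'d) set \<Rightarrow> (real^'d \<Rightarrow> real) \<Rightarrow> 'd::finite mesh \<Rightarrow> 'd dofs set" where
  "V_omega \<Omega> \<Gamma>D \<omega> D =
     (if emeasure surface \<Gamma>D > 0 then V_dirichlet \<Omega> \<Gamma>D D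
      else {v. (LINT x|lebesgue_on \<Omega>. \<omega> x * cell_fun D v x) = 0})"

definition local_seminorm_sq :: "'d::finite mesh \<Rightarrow> (real^'d) set \<Rightarrow> 'd dofs \<Rightarrow> real" where
  "local_seminorm_sq D K v =
     (\<Sum>\<sigma>\<in>faces_of D K. area \<sigma> / dist_face D K \<sigma> * (fst v K - snd v \<sigma>)\<^sup>2)"

definition seminorm :: "'d::finite mesh \<Rightarrow> 'd dofs \<Rightarrow> real" where
  "seminorm D v = sqrt (\<Sum>K\<in>cells D. local_seminorm_sq D K v)"

definition cell_mean :: "(real^'d \<Rightarrow> real) \<Rightarrow> (real^'d) set \<Rightarrow> real" where
  "cell_mean w K = (1 / vol K) * (LINT x|lebesgue_on K. w x)"

definition face_mean :: "(real^'d \<Rightarrow> real) \<Rightarrow> (real^'d) set \<Rightarrow> real" where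
  "face_mean w \<sigma> = (1 / area \<sigma>) * (LINT x|restrict_space surface \<sigma>. w x)"

definition means :: "(real^'d \<Rightarrow> real) \<Rightarrow> 'd dofs" where
  "means w = (cell_mean w, face_mean w)"

definition dofs_mult :: "'d dofs \<Rightarrow> 'd dofs \<Rightarrow> 'd::finite dofs" where
  "dofs_mult v w = ((\<lambda>K. fst v K * fst w K), (\<lambda>\<sigma>. snd v \<sigma> * snd w \<sigma>))"

section \<open>Discrete gradient and bilinear form\<close>

definition mean_gradient :: "'d::finite mesh \<Rightarrow> (real^'d) set \<Rightarrow> 'd dofs \<Rightarrow> real^'d" where
  "mean_gradient D K v = (1 / vol K) *\<^sub>R
     (\<Sum>\<sigma>\<in>faces_of D K. (area \<sigma> * (snd v \<sigma> - fst v K)) *\<^sub>R outer_normal K \<sigma>)"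

definition face_gradient ::
  "real \<Rightarrow> 'd::finite mesh \<Rightarrow> (real^'d) set \<Rightarrow> (real^'d) set \<Rightarrow> 'd dofs \<Rightarrow> real^'d" where
  "face_gradient \<eta> D K \<sigma> v = mean_gradient D K v +
     (\<eta> / dist_face D K \<sigma> *
       (snd v \<sigma> - fst v K - mean_gradient D K v \<bullet> (barycentre \<sigma> - centre D K))) *\<^sub>R
     outer_normal K \<sigma>"

text \<open>The pyramids of a cell are disjoint; off the pyramids (a null set) the value is \<open>0\<close>.\<close>

definition cell_gradient ::
  "real \<Rightarrow> 'd::finite mesh \<Rightarrow> (real^'d) set \<Rightarrow> 'd dofs \<Rightarrow> real^'d \<Rightarrow> real^'d" where
  "cell_gradient \<eta> D K v x =
     (\<Sum>\<sigma>\<in>faces_of D K. indicator (pyramid D K \<sigma>) x *\<^sub>R face_gradient \<eta> D K \<sigma> v)"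

definition a_form ::
  "real \<Rightarrow> (real^'d \<Rightarrow> real) \<Rightarrow> (real^'d \<Rightarrow> real^'d^'d) \<Rightarrow> 'd::finite mesh \<Rightarrow> 'd dofs \<Rightarrow> 'd dofs \<Rightarrow> real"
  where
  "a_form \<eta> \<omega> \<Lambda> D \<rho> v = (\<Sum>K\<in>cells D. LINT x|lebesgue_on K.
     \<omega> x * ((\<Lambda> x *v cell_gradient \<eta> D K \<rho> x) \<bullet> cell_gradient \<eta> D K v x))"

section \<open>Schemes\<close>

definition load ::
  "(real^'d) set \<Rightarrow> (real^'d) set \<Rightarrow> (real^'d \<Rightarrow> real) \<Rightarrow> (real^'d \<Rightarrow> real) \<Rightarrow> 'd::finite mesh \<Rightarrow>
   'd dofs \<Rightarrow> real" where
  "load \<Omega> \<Gamma>N f gN D v =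
     L2_inner (lebesgue_on \<Omega>) f (cell_fun D v) + L2_inner (restrict_space surface \<Gamma>N) gN (face_fun D v)"

definition stationary_solution ::
  "(real^'d) set \<Rightarrow> (real^'d) set \<Rightarrow> (real^'d) set \<Rightarrow> real \<Rightarrow> (real^'d \<Rightarrow> real) \<Rightarrow>
   (real^'d \<Rightarrow> real^'d^'d) \<Rightarrow> (real^'d \<Rightarrow> real) \<Rightarrow> (real^'d \<Rightarrow> real) \<Rightarrow> 'd::finite mesh \<Rightarrow>
   'd dofs \<Rightarrow> bool" where
  "stationary_solution \<Omega> \<Gamma>D \<Gamma>N \<eta> \<omega> \<Lambda> f gN D \<rho> \<longleftrightarrow>
     \<rho> \<in> V_omega \<Omega> \<Gamma>D \<omega> D \<and>
     (\<forall>v\<in>V_omega \<Omega> \<Gamma>D \<omega> D. a_form \<eta> \<omega> \<Lambda> D \<rho> v = load \<Omega> \<Gamma>N f gN D v)"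

text \<open>Only the cell values of the initial vector \<open>\<rho> 0\<close> are prescribed (and used).\<close>

definition evolution_solution ::
  "(real^'d) set \<Rightarrow> (real^'d) set \<Rightarrow> (real^'d) set \<Rightarrow> real \<Rightarrow> (real^'d \<Rightarrow> real) \<Rightarrow>
   (real^'d \<Rightarrow> real^'d^'d) \<Rightarrow> (real^'d \<Rightarrow> real) \<Rightarrow> (real^'d \<Rightarrow> real) \<Rightarrow> (real^'d \<Rightarrow> real) \<Rightarrow>
   real \<Rightarrow> 'd::finite mesh \<Rightarrow> (nat \<Rightarrow> 'd dofs) \<Rightarrow> bool" where
  "evolution_solution \<Omega> \<Gamma>D \<Gamma>N \<eta> \<omega> \<Lambda> f gN uin dt D \<rho> \<longleftrightarrow>
     (\<forall>K\<in>cells D. fst (\<rho> 0) K = 1 / (cell_mean \<omega> K * vol K) * (LINT x|lebesgue_on K. uin x)) \<and>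
     (\<forall>n\<ge>1. \<rho> n \<in> V_omega \<Omega> \<Gamma>D \<omega> D \<and>
       (\<forall>v\<in>V_omega \<Omega> \<Gamma>D \<omega> D.
          1 / dt * L2_inner (lebesgue_on \<Omega>)
            (\<lambda>x. cell_fun D (\<rho> n) x - cell_fun D (\<rho> (n - 1)) x)
            (\<lambda>x. cell_fun D (means \<omega>) x * cell_fun D v x)
          + a_form \<eta> \<omega> \<Lambda> D (\<rho> n) v = load \<Omega> \<Gamma>N f gN D v))"

section \<open>Energy and dissipation\<close>

definition energy ::
  "(real^'d) set \<Rightarrow> (real^'d \<Rightarrow> real) \<Rightarrow> 'd::finite mesh \<Rightarrow> (nat \<Rightarrow> 'd dofs) \<Rightarrow> 'd dofs \<Rightarrow> nat \<Rightarrow> real"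
  where
  "energy \<Omega> \<omega> D \<rho> \<rho>inf n =
     1/2 * (L2_norm (weighted \<Omega> \<omega>) (\<lambda>x. cell_fun D (\<rho> n) x - cell_fun D \<rho>inf x))\<^sup>2"

definition dissipation ::
  "real \<Rightarrow> (real^'d \<Rightarrow> real) \<Rightarrow> (real^'d \<Rightarrow> real^'d^'d) \<Rightarrow> 'd::finite mesh \<Rightarrow>
   (nat \<Rightarrow> 'd dofs) \<Rightarrow> 'd dofs \<Rightarrow> nat \<Rightarrow> real" where
  "dissipation \<eta> \<omega> \<Lambda> D \<rho> \<rho>inf n = a_form \<eta> \<omega> \<Lambda> D (\<rho> n - \<rho>inf) (\<rho> n - \<rho>inf)"

end

theory Submission
  imports Defs
begin

text \<open>
  The scheme is an implicit Euler step for a gradient flow, and the proof is the classical relative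
  energy argument. Let \<open>v = \<rho> (n + 1) - \<rho>inf\<close> and \<open>w = \<rho> n - \<rho>inf\<close>. The space
  of unknowns is linear, so \<open>v\<close> is a test function for both schemes; subtracting them cancels the
  load and leaves
  \<open>(v - w, \<omega> v) / dt + a(v, v) = 0\<close>. The elementary inequality
  \<open>v\<^sup>2 / 2 - w\<^sup>2 / 2 \<le> (v - w) v\<close> turns this into the dissipation inequality
  (\<open>energy_dissipation\<close>).

  The dissipation controls the energy in two steps: \<open>a(v, v)\<close> dominates
  \<open>om_lo lam_lo \<alpha> |v|\<^sup>2\<close> by the pointwise bounds on weight and diffusion
  (\<open>a_form_coercive\<close>), and the discrete Poincare inequality bounds the weighted norm of \<open>v\<close> by
  its seminorm. In the pure Neumann case the hypothesis speaks of functions whose plain mean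
  vanishes whereas \<open>v\<close> has vanishing weighted mean; the gap closes because a function of zero
  weighted mean is the shortest, in the weighted norm, among all its translates by constants
  (\<open>weighted_poincare_wirtinger\<close>). So \<open>\<nu> E \<le> D\<close>, which gives the contraction. Iterating it
  and passing from \<open>\<rho>\<close> to \<open>u\<close>, which is multiplication by cell means lying between
  \<open>om_lo\<close> and \<open>om_hi\<close>, gives the decay in the plain norm.

  Since functions of the cell unknowns vanish off the cells, all their integrals over the domain are
  finite sums with the plain and weighted measures of the cells as coefficients. The
  delicate point of integration is the linearity of the bilinear form in its first argument: it holds
  because the integrand is bounded and measurable on each cell, and measurability rests on that of
  the pyramids (\<open>pyramid_borel\<close>).
\<close>

section \<open>Cellwise constant functions\<close>

lemma cell_fun_diff: "cell_fun D (v - w) x = cell_fun D v x - cell_fun D w x"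
  by (simp add: cell_fun_def sum_subtractf algebra_simps)

lemma cell_fun_on_cell:
  assumes "finite (cells D)" "pairwise disjnt (cells D)" "K \<in> cells D" "x \<in> K"
  shows "cell_fun D v x = fst v K"
proof -
  have "cell_fun D v x = (\<Sum>L\<in>cells D. if L = K then fst v K else 0)"
    unfolding cell_fun_def using assms
    by (intro sum.cong) (auto simp: pairwise_def disjnt_iff indicator_def)
  then show ?thesis using assms by simp
qed

lemma cell_fun_off_cells:
  assumes "\<forall>K\<in>cells D. x \<notin> K"
  shows "cell_fun D v x = 0"
  using assms by (simp add: cell_fun_def)

text \<open>
  Cells are disjoint, so products and squares of cellwise constant functions are again cellwise
  constant, and every integral needed below is linear in some \<open>cell_fun\<close>.
\<close>

lemma cell_fun_mult:
  assumes "finite (cells D)" "pairwise disjnt (cells D)"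
  shows "cell_fun D (dofs_mult v w) x = cell_fun D v x * cell_fun D w x"
proof (cases "\<exists>K\<in>cells D. x \<in> K")
  case True
  then show ?thesis using assms by (auto simp: cell_fun_on_cell dofs_mult_def)
next
  case False
  then show ?thesis by (simp add: cell_fun_off_cells)
qed

lemma integral_mult_cell_fun:
  fixes g :: "real^'d::finite \<Rightarrow> real"
  assumes cell: "\<And>K. K \<in> cells D \<Longrightarrow> K \<in> sets lebesgue \<and> K \<subseteq> \<Omega>"
    and \<Omega>: "\<Omega> \<in> sets lebesgue"
    and g: "\<And>K. K \<in> cells D \<Longrightarrow> integrable (lebesgue_on K) g"
  shows "integrable (lebesgue_on \<Omega>) (\<lambda>x. g x * cell_fun D v x)"
    and "(LINT x|lebesgue_on \<Omega>. g x * cell_fun D v x)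
      = (\<Sum>K\<in>cells D. fst v K * (LINT x|lebesgue_on K. g x))"
proof -
  have ind: "indicator \<Omega> x * (indicator K x * g x) = indicator K x * g x"
    if "K \<in> cells D" for K x
    using cell[OF that] by (auto simp: indicator_def)
  have int: "integrable (lebesgue_on \<Omega>) (\<lambda>x. indicator K x * g x)" if "K \<in> cells D" for K
    using g[OF that] cell[OF that] \<Omega> by (simp add: integrable_restrict_space ind[OF that])
  have lint: "(LINT x|lebesgue_on \<Omega>. indicator K x * g x) = (LINT x|lebesgue_on K. g x)"
    if "K \<in> cells D" for K
    using cell[OF that] \<Omega> by (simp add: integral_restrict_space ind[OF that])
  have eq: "(\<lambda>x. g x * cell_fun D v x) = (\<lambda>x. \<Sum>K\<in>cells D. fst v K * (indicator K x * g x))"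
    by (simp add: cell_fun_def sum_distrib_left mult_ac)
  show "integrable (lebesgue_on \<Omega>) (\<lambda>x. g x * cell_fun D v x)"
    unfolding eq using int by (intro Bochner_Integration.integrable_sum integrable_mult_right) auto
  show "(LINT x|lebesgue_on \<Omega>. g x * cell_fun D v x)
      = (\<Sum>K\<in>cells D. fst v K * (LINT x|lebesgue_on K. g x))"
    unfolding eq using int
    by (subst Bochner_Integration.integral_sum) (auto intro!: sum.cong simp: lint)
qed

section \<open>Weighted masses of the cells\<close>

text \<open>
  The part of the data on which the energy and the two \<open>L2\<close> norms depend.
\<close>

locale weighted_mesh =
  fixes \<Omega> :: "(real^'d::finite) set" and D :: "'d mesh"
    and \<omega> :: "real^'d \<Rightarrow> real" and om_lo om_hi :: real
  assumes open_domain: "open \<Omega>" and bounded_domain: "bounded \<Omega>"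
    and finite_cells: "finite (cells D)" and disjoint_cells: "pairwise disjnt (cells D)"
    and cell: "\<And>K. K \<in> cells D \<Longrightarrow> open K \<and> K \<subseteq> \<Omega> \<and> 0 < vol K"
    and continuous_weight: "continuous_on \<Omega> \<omega>"
    and om_lo_pos: "0 < om_lo"
    and weight_bounds: "\<And>x. x \<in> \<Omega> \<Longrightarrow> om_lo \<le> \<omega> x \<and> \<omega> x \<le> om_hi"
begin

definition mass :: "(real^'d) set \<Rightarrow> real" where
  "mass K = (LINT x|lebesgue_on K. \<omega> x)"

definition weighted_sq :: "'d dofs \<Rightarrow> real" where
  "weighted_sq v = (\<Sum>K\<in>cells D. mass K * (fst v K)\<^sup>2)"

definition plain_sq :: "'d dofs \<Rightarrow> real" where
  "plain_sq v = (\<Sum>K\<in>cells D. vol K * (fst v K)\<^sup>2)"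

lemma domain_lebesgue: "\<Omega> \<in> sets lebesgue"
  using open_domain by simp

lemma cell_lmeasurable: "K \<in> cells D \<Longrightarrow> K \<in> lmeasurable"
  using cell bounded_subset[OF bounded_domain] by (simp add: lmeasurable_open)

lemma cell_lebesgue: "K \<in> cells D \<Longrightarrow> K \<in> sets lebesgue \<and> K \<subseteq> \<Omega>"
  using cell_lmeasurable cell by (simp add: fmeasurableD)

lemma finite_measure_cell: "K \<in> cells D \<Longrightarrow> finite_measure (lebesgue_on K)"
  using cell_lmeasurable by (rule finite_measure_lebesgue_on)

lemma weight_measurable: "\<omega> \<in> borel_measurable (lebesgue_on \<Omega>)"
  using continuous_weight domain_lebesgue by (rule continuous_imp_measurable_on_sets_lebesgue)

lemma weight_measurable_cell: "K \<in> cells D \<Longrightarrow> \<omega> \<in> borel_measurable (lebesgue_on K)"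
  using weight_measurable cell by (auto intro: measurable_restrict_mono)

lemma cell_weight_bounds:
  "K \<in> cells D \<Longrightarrow> x \<in> K \<Longrightarrow> om_lo \<le> \<omega> x \<and> \<omega> x \<le> om_hi"
  using cell weight_bounds by blast

lemma integrable_weight_cell:
  assumes K: "K \<in> cells D"
  shows "integrable (lebesgue_on K) \<omega>"
proof (rule finite_measure.integrable_const_bound[OF finite_measure_cell[OF K]])
  show "AE x in lebesgue_on K. norm (\<omega> x) \<le> om_hi"
    using cell_weight_bounds[OF K] om_lo_pos by (intro AE_I2) fastforce
qed (rule weight_measurable_cell[OF K])

lemma integral_const_cell:
  "K \<in> cells D \<Longrightarrow> (LINT x|lebesgue_on K. c) = c * vol K" for c :: real
  using cell_lebesgue by (simp add: vol_def measure_restrict_space)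

lemma mass_bounds:
  assumes K: "K \<in> cells D"
  shows "om_lo * vol K \<le> mass K" and "mass K \<le> om_hi * vol K"
proof -
  interpret finite_measure "lebesgue_on K" by (rule finite_measure_cell[OF K])
  have "(LINT x|lebesgue_on K. om_lo) \<le> mass K" "mass K \<le> (LINT x|lebesgue_on K. om_hi)"
    unfolding mass_def
    by (intro integral_mono integrable_const integrable_weight_cell[OF K];
        simp add: cell_weight_bounds[OF K])+
  then show "om_lo * vol K \<le> mass K" "mass K \<le> om_hi * vol K"
    unfolding integral_const_cell[OF K] .
qed

lemma mass_pos: "K \<in> cells D \<Longrightarrow> 0 < mass K"
  using mass_bounds(1)[of K] cell[of K] om_lo_pos by (smt (verit) mult_pos_pos)

lemma cell_mean_weight: "cell_mean \<omega> K = mass K / vol K"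
  by (simp add: cell_mean_def mass_def)

lemma integral_weight_cell_fun:
  "(LINT x|lebesgue_on \<Omega>. \<omega> x * cell_fun D v x) = (\<Sum>K\<in>cells D. mass K * fst v K)"
  using integral_mult_cell_fun(2)[OF cell_lebesgue domain_lebesgue integrable_weight_cell]
  by (simp add: mass_def mult.commute)

lemma integral_cell_fun:
  shows "(LINT x|lebesgue_on \<Omega>. cell_fun D v x) = (\<Sum>K\<in>cells D. vol K * fst v K)"
    and integrable_cell_fun: "integrable (lebesgue_on \<Omega>) (cell_fun D v)"
proof -
  have "integrable (lebesgue_on K) (\<lambda>x. 1::real)" if "K \<in> cells D" for K
    using finite_measure.integrable_const[OF finite_measure_cell[OF that]] .
  note * = integral_mult_cell_fun[where D = D and v = v, OF cell_lebesgue domain_lebesgue this]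
  have "(LINT x|lebesgue_on \<Omega>. cell_fun D v x) = (\<Sum>K\<in>cells D. fst v K * (LINT x|lebesgue_on K. 1))"
    using *(2) by (simp only: mult_1)
  also have "\<dots> = (\<Sum>K\<in>cells D. vol K * fst v K)"
    by (intro sum.cong refl, subst integral_const_cell) auto
  finally show "(LINT x|lebesgue_on \<Omega>. cell_fun D v x) = (\<Sum>K\<in>cells D. vol K * fst v K)" .
  show "integrable (lebesgue_on \<Omega>) (cell_fun D v)"
    using *(1) by simp
qed

lemma cell_fun_sq: "(cell_fun D v x)\<^sup>2 = cell_fun D (dofs_mult v v) x"
  using finite_cells disjoint_cells by (simp add: cell_fun_mult power2_eq_square)

lemma L2_norm_cell_fun_sq: "(L2_norm (lebesgue_on \<Omega>) (cell_fun D v))\<^sup>2 = plain_sq v"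
  unfolding L2_norm_def plain_sq_def
  by (simp add: cell_fun_sq integral_cell_fun dofs_mult_def power2_eq_square[symmetric])
     (auto intro!: sum_nonneg mult_nonneg_nonneg simp: vol_def)

lemma L2_norm_weighted_cell_fun_sq: "(L2_norm (weighted \<Omega> \<omega>) (cell_fun D v))\<^sup>2 = weighted_sq v"
proof -
  have "(\<lambda>x. (cell_fun D v x)\<^sup>2) \<in> borel_measurable (lebesgue_on \<Omega>)"
    unfolding cell_fun_sq using integrable_cell_fun by (rule borel_measurable_integrable)
  moreover have "AE x in lebesgue_on \<Omega>. 0 \<le> \<omega> x"
    using weight_bounds om_lo_pos by (intro AE_I2) fastforce
  ultimately have "(LINT x|weighted \<Omega> \<omega>. (cell_fun D v x)\<^sup>2)
      = (LINT x|lebesgue_on \<Omega>. \<omega> x * (cell_fun D v x)\<^sup>2)"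
    unfolding weighted_def using weight_measurable by (simp add: integral_density)
  also have "\<dots> = weighted_sq v"
    unfolding cell_fun_sq integral_weight_cell_fun weighted_sq_def
    by (simp add: dofs_mult_def power2_eq_square)
  moreover have "0 \<le> weighted_sq v"
    unfolding weighted_sq_def by (auto intro!: sum_nonneg mult_nonneg_nonneg less_imp_le[OF mass_pos])
  ultimately show ?thesis by (simp add: L2_norm_def)
qed

lemma energy_eq: "energy \<Omega> \<omega> D \<rho> \<rho>inf n = 1/2 * weighted_sq (\<rho> n - \<rho>inf)"
  unfolding energy_def cell_fun_diff[symmetric] L2_norm_weighted_cell_fun_sq ..

lemma weighted_sq_le: "weighted_sq v \<le> om_hi * plain_sq v"
  unfolding weighted_sq_def plain_sq_def sum_distrib_left mult.assoc[symmetric]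
  by (intro sum_mono mult_right_mono mass_bounds) auto

text \<open>
  The accumulation term of the scheme. On a cell, volume times the mean of the weight is the mass, so
  the discrete weight yields the same quadratic form as the exact weight in the energy.
\<close>

lemma L2_inner_increment_means:
  "L2_inner (lebesgue_on \<Omega>) (\<lambda>x. cell_fun D v x - cell_fun D w x)
     (\<lambda>x. cell_fun D (means \<omega>) x * cell_fun D z x)
   = (\<Sum>K\<in>cells D. mass K * ((fst v K - fst w K) * fst z K))"
proof -
  have "(cell_fun D v x - cell_fun D w x) * (cell_fun D (means \<omega>) x * cell_fun D z x)
      = cell_fun D (dofs_mult (v - w) (dofs_mult (means \<omega>) z)) x" for x
    using finite_cells disjoint_cells by (simp add: cell_fun_mult cell_fun_diff)
  then show ?thesis
    unfolding L2_inner_def integral_cell_fun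
    by (auto simp: integral_cell_fun dofs_mult_def means_def cell_mean_weight mult_ac
        dest!: cell intro!: sum.cong)
qed

lemma V_omega_diff:
  assumes "v \<in> V_omega \<Omega> \<Gamma>D \<omega> D" "w \<in> V_omega \<Omega> \<Gamma>D \<omega> D"
  shows "v - w \<in> V_omega \<Omega> \<Gamma>D \<omega> D"
  using assms unfolding V_omega_def V_dirichlet_def
  by (auto simp: integral_weight_cell_fun right_diff_distrib sum_subtractf split: if_splits)

lemma L2_norm_density_diff_sq:
  "(L2_norm (lebesgue_on \<Omega>)
      (\<lambda>x. cell_fun D (dofs_mult (means \<omega>) v) x - cell_fun D (dofs_mult (means \<omega>) w) x))\<^sup>2
   = (\<Sum>K\<in>cells D. mass K * (mass K / vol K) * (fst (v - w) K)\<^sup>2)"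
proof -
  have "(L2_norm (lebesgue_on \<Omega>)
      (\<lambda>x. cell_fun D (dofs_mult (means \<omega>) v) x - cell_fun D (dofs_mult (means \<omega>) w) x))\<^sup>2
    = plain_sq (dofs_mult (means \<omega>) v - dofs_mult (means \<omega>) w)"
    unfolding cell_fun_diff[symmetric] by (rule L2_norm_cell_fun_sq)
  also have "\<dots> = (\<Sum>K\<in>cells D. mass K * (mass K / vol K) * (fst (v - w) K)\<^sup>2)"
    unfolding plain_sq_def
  proof (rule sum.cong[OF refl])
    fix K assume "K \<in> cells D"
    then have "vol K \<noteq> 0" using cell by force
    moreover have "fst (dofs_mult (means \<omega>) v - dofs_mult (means \<omega>) w) K
        = mass K / vol K * fst (v - w) K"
      by (simp add: dofs_mult_def means_def cell_mean_weight algebra_simps)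
    ultimately show "vol K * (fst (dofs_mult (means \<omega>) v - dofs_mult (means \<omega>) w) K)\<^sup>2
        = mass K * (mass K / vol K) * (fst (v - w) K)\<^sup>2"
      by (simp add: power2_eq_square)
  qed
  finally show ?thesis .
qed

text \<open>
  Multiplying by the cell means of the weight compares the plain norm of the densities \<open>u\<close> with
  the weighted norm of \<open>\<rho>\<close>: one factor of the mean is absorbed in the mass of the cell and only
  the other one has to be estimated.
\<close>

lemma L2_norm_density_diff_bounds:
  fixes v w :: "'d dofs"
  defines "U \<equiv> (L2_norm (lebesgue_on \<Omega>)
      (\<lambda>x. cell_fun D (dofs_mult (means \<omega>) v) x - cell_fun D (dofs_mult (means \<omega>) w) x))\<^sup>2"
  shows "om_lo * weighted_sq (v - w) \<le> U" and "U \<le> om_hi * weighted_sq (v - w)"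
proof -
  have "om_lo \<le> mass K / vol K" "mass K / vol K \<le> om_hi" "0 \<le> mass K" if "K \<in> cells D" for K
    using mass_bounds[OF that] mass_pos[OF that] cell[OF that]
    by (simp_all add: pos_le_divide_eq pos_divide_le_eq)
  note b = this
  have s: "c * weighted_sq z = (\<Sum>K\<in>cells D. mass K * c * (fst z K)\<^sup>2)" for c z
    by (simp add: weighted_sq_def sum_distrib_left mult_ac)
  show "om_lo * weighted_sq (v - w) \<le> U" "U \<le> om_hi * weighted_sq (v - w)"
    unfolding U_def L2_norm_density_diff_sq s
    by (intro sum_mono mult_right_mono mult_left_mono b; simp)+
qed

text \<open>
  Orthogonality: a vector of zero weighted mean is orthogonal to the constants in the weighted inner
  product, so translating it by a constant cannot shorten it.
\<close>

lemma weighted_sq_shift: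
  assumes mean: "(\<Sum>K\<in>cells D. mass K * fst v K) = 0"
  shows "weighted_sq v \<le> weighted_sq (v - ((\<lambda>_. c), (\<lambda>_. c)))"
proof -
  have "weighted_sq (v - ((\<lambda>_. c), (\<lambda>_. c)))
      = (\<Sum>K\<in>cells D. mass K * (fst v K)\<^sup>2 - 2 * c * (mass K * fst v K) + mass K * c\<^sup>2)"
    unfolding weighted_sq_def by (intro sum.cong) (auto simp: power2_eq_square algebra_simps)
  also have "\<dots> = weighted_sq v - 2 * c * (\<Sum>K\<in>cells D. mass K * fst v K) + (\<Sum>K\<in>cells D. mass K * c\<^sup>2)"
    unfolding sum.distrib sum_subtractf sum_distrib_left weighted_sq_def ..
  also have "\<dots> \<ge> weighted_sq v"
    using mean by (auto intro!: sum_nonneg mult_nonneg_nonneg less_imp_le[OF mass_pos])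
  finally show ?thesis .
qed

text \<open>
  Translate the vector so that its plain mean vanishes: the weighted norm does not decrease, the
  seminorm does not change, and the unweighted inequality applies to the translate.
\<close>

lemma weighted_poincare_wirtinger:
  assumes C: "0 \<le> C" and pw: "\<And>v. v \<in> V_neumann \<Omega> D \<Longrightarrow>
      L2_norm (lebesgue_on \<Omega>) (cell_fun D v) \<le> C * seminorm D v"
    and mean: "(\<Sum>K\<in>cells D. mass K * fst v K) = 0"
  shows "weighted_sq v \<le> om_hi * (C * seminorm D v)\<^sup>2"
proof (cases "cells D = {}")
  case True
  then show ?thesis by (simp add: weighted_sq_def seminorm_def)
next
  case False
  define V where "V = (\<Sum>K\<in>cells D. vol K)"
  have "0 < V" unfolding V_def using False finite_cells cell by (intro sum_pos) auto
  define c where "c = (\<Sum>K\<in>cells D. vol K * fst v K) / V"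
  define w where "w = v - ((\<lambda>_. c), (\<lambda>_. c))"
  have "(\<Sum>K\<in>cells D. vol K * fst w K) = (\<Sum>K\<in>cells D. vol K * fst v K) - V * c"
    by (simp add: w_def V_def right_diff_distrib sum_subtractf sum_distrib_right)
  then have "w \<in> V_neumann \<Omega> D"
    using \<open>0 < V\<close> by (simp add: V_neumann_def integral_cell_fun c_def)
  have "seminorm D w = seminorm D v"
    by (simp add: seminorm_def local_seminorm_sq_def w_def)
  obtain K where "K \<in> cells D" using False by blast
  with mass_pos[of K] mass_bounds(2)[of K] cell[of K] have "0 \<le> om_hi"
    by (smt (verit) mult_nonneg_nonneg zero_less_mult_iff)
  have "weighted_sq v \<le> weighted_sq w"
    unfolding w_def by (rule weighted_sq_shift[OF mean])
  also have "\<dots> \<le> om_hi * plain_sq w" by (rule weighted_sq_le)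
  also have "plain_sq w \<le> (C * seminorm D w)\<^sup>2"
    unfolding L2_norm_cell_fun_sq[symmetric]
    using pw[OF \<open>w \<in> _\<close>] by (intro power_mono) (auto simp: L2_norm_def)
  finally show ?thesis
    using \<open>0 \<le> om_hi\<close> \<open>seminorm D w = seminorm D v\<close> by (simp add: mult_left_mono)
qed

end
section \<open>Discrete gradients and the bilinear form\<close>

text \<open>
  The base is relatively open in its affine hull, hence a countable union of compact sets. The pyramid
  is the continuous image of the product of the base with an open interval, so it is a countable
  union of compact sets too. The positive distance keeps the apex out of the base, where
  the segments would degenerate.
\<close>

lemma pyramid_borel:
  assumes face: "openin (top_of_set (affine hull \<sigma>)) \<sigma>" and apex: "0 < dist_face D K \<sigma>"
  shows "pyramid D K \<sigma> \<in> sets borel"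
proof -
  obtain U where "open U" and U: "\<sigma> = affine hull \<sigma> \<inter> U"
    using face by (auto simp: openin_open)
  obtain C :: "nat \<Rightarrow> _" where C: "\<And>n. compact (C n)" "\<Union>(range C) = U"
    using open_Union_compact_subsets[OF \<open>open U\<close>] by metis
  obtain I :: "nat \<Rightarrow> real set" where I: "\<And>n. compact (I n)" "\<Union>(range I) = {0<..<1}"
    using open_Union_compact_subsets[OF open_greaterThanLessThan] by metis
  define c where "c = centre D K"
  define g where "g = (\<lambda>(t, y). (1 - t) *\<^sub>R c + t *\<^sub>R y)"
  have "c \<notin> affine hull \<sigma>"
    using apex by (auto simp: dist_face_def c_def)
  then have "c \<notin> \<sigma>" using hull_inc by metis
  then have "pyramid D K \<sigma> = (\<Union>y\<in>\<sigma>. (\<lambda>t. g (t, y)) ` {0<..<1})"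
    unfolding pyramid_def c_def[symmetric] g_def open_segment_image_interval by auto
  also have "\<dots> = g ` ({0<..<1} \<times> \<sigma>)"
    by auto
  also have "{0<..<1} \<times> \<sigma> = (\<Union>m. \<Union>n. I m \<times> (affine hull \<sigma> \<inter> C n))"
    by (subst U, unfold C(2)[symmetric] I(2)[symmetric]) auto
  also have "g ` \<dots> = (\<Union>m. \<Union>n. g ` (I m \<times> (affine hull \<sigma> \<inter> C n)))"
    by (simp add: image_UN)
  finally have "pyramid D K \<sigma> = (\<Union>m. \<Union>n. g ` (I m \<times> (affine hull \<sigma> \<inter> C n)))" .
  moreover have "compact (g ` (I m \<times> (affine hull \<sigma> \<inter> C n)))" for m n
    unfolding g_def case_prod_unfold using I C
    by (intro compact_continuous_image continuous_intros compact_Times closed_Int_compact) auto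
  ultimately show ?thesis
    by (auto intro!: sets.countable_UN intro: borel_compact)
qed

lemma mean_gradient_diff: "mean_gradient D K (v - w) = mean_gradient D K v - mean_gradient D K w"
proof -
  have "area \<sigma> * (snd (v - w) \<sigma> - fst (v - w) K)
      = area \<sigma> * (snd v \<sigma> - fst v K) - area \<sigma> * (snd w \<sigma> - fst w K)" for \<sigma>
    by (simp add: algebra_simps)
  then show ?thesis
    by (simp add: mean_gradient_def scaleR_diff_left scaleR_diff_right sum_subtractf del: fst_diff snd_diff)
qed

lemma face_gradient_diff:
  "face_gradient \<eta> D K \<sigma> (v - w) = face_gradient \<eta> D K \<sigma> v - face_gradient \<eta> D K \<sigma> w"
proof -
  have eq: "c * (snd (v - w) \<sigma> - fst (v - w) K - (a - b) \<bullet> z)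
      = c * (snd v \<sigma> - fst v K - a \<bullet> z) - c * (snd w \<sigma> - fst w K - b \<bullet> z)"
    for a b z :: "real^'d" and c
    by (simp add: inner_diff_left algebra_simps)
  show ?thesis
    unfolding face_gradient_def mean_gradient_diff eq scaleR_diff_left by simp
qed

lemma cell_gradient_diff:
  "cell_gradient \<eta> D K (v - w) x = cell_gradient \<eta> D K v x - cell_gradient \<eta> D K w x"
  by (simp add: cell_gradient_def face_gradient_diff scaleR_diff_right sum_subtractf)

lemma norm_cell_gradient_le:
  "norm (cell_gradient \<eta> D K v x) \<le> (\<Sum>\<sigma>\<in>faces_of D K. norm (face_gradient \<eta> D K \<sigma> v))"
  unfolding cell_gradient_def by (rule sum_norm_le) (simp add: indicator_def)

lemma continuous_matrix_vector_pair:
  "continuous_on UNIV (\<lambda>p::(real^'n^'m) \<times> (real^'n). fst p *v snd p)"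
  unfolding matrix_vector_mult_def by (intro continuous_intros)

lemma discretisation_cells:
  assumes "discretisation \<Omega> \<Gamma>D \<Gamma>N D"
  shows "finite (cells D)" and "pairwise disjnt (cells D)"
    and "\<And>K. K \<in> cells D \<Longrightarrow> open K \<and> K \<subseteq> \<Omega> \<and> 0 < vol K"
  using assms by (simp_all add: discretisation_def)

lemma discretisation_faces:
  assumes disc: "discretisation \<Omega> \<Gamma>D \<Gamma>N D" and K: "K \<in> cells D" "\<sigma> \<in> faces_of D K"
  shows "openin (top_of_set (affine hull \<sigma>)) \<sigma> \<and> 0 < dist_face D K \<sigma>"
proof -
  have "faces_of D K \<subseteq> faces D" and dist: "0 < dist_face D K \<sigma>"
    using disc K by (simp_all add: discretisation_def)
  then have "\<sigma> \<in> faces D" using K(2) by auto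
  then have "openin (top_of_set (affine hull \<sigma>)) \<sigma>"
    using disc by (simp add: discretisation_def)
  with dist show ?thesis by simp
qed

locale diffusion_mesh = weighted_mesh \<Omega> D \<omega> om_lo om_hi
  for \<Omega> :: "(real^'d::finite) set" and D :: "'d mesh"
    and \<omega> :: "real^'d \<Rightarrow> real" and om_lo om_hi :: real +
  fixes \<Lambda> :: "real^'d \<Rightarrow> real^'d^'d" and lam_lo lam_hi :: real
  assumes diffusion_measurable: "\<Lambda> \<in> borel_measurable (lebesgue_on \<Omega>)"
    and lam_lo_pos: "0 < lam_lo"
    and diffusion_bounds: "AE x in lebesgue_on \<Omega>. \<forall>\<xi>. \<xi> \<bullet> (\<Lambda> x *v \<xi>) \<ge> lam_lo * (norm \<xi>)\<^sup>2 \<and>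
         norm (\<Lambda> x *v \<xi>) \<le> lam_hi * norm \<xi>"
    and faces_open: "\<And>K \<sigma>. K \<in> cells D \<Longrightarrow> \<sigma> \<in> faces_of D K \<Longrightarrow>
         openin (top_of_set (affine hull \<sigma>)) \<sigma> \<and> 0 < dist_face D K \<sigma>"
begin

lemma diffusion_measurable_cell:
  "K \<in> cells D \<Longrightarrow> \<Lambda> \<in> borel_measurable (lebesgue_on K)"
  using diffusion_measurable cell by (auto intro: measurable_restrict_mono)

lemma diffusion_bounds_cell:
  assumes "K \<in> cells D"
  shows "AE x in lebesgue_on K. \<forall>\<xi>. \<xi> \<bullet> (\<Lambda> x *v \<xi>) \<ge> lam_lo * (norm \<xi>)\<^sup>2 \<and>
         norm (\<Lambda> x *v \<xi>) \<le> lam_hi * norm \<xi>"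
proof -
  have "AE x in lebesgue. x \<in> \<Omega> \<longrightarrow> (\<forall>\<xi>. \<xi> \<bullet> (\<Lambda> x *v \<xi>) \<ge> lam_lo * (norm \<xi>)\<^sup>2 \<and>
         norm (\<Lambda> x *v \<xi>) \<le> lam_hi * norm \<xi>)"
    using diffusion_bounds domain_lebesgue by (simp add: AE_restrict_space_iff)
  then have "AE x in lebesgue. x \<in> K \<longrightarrow> (\<forall>\<xi>. \<xi> \<bullet> (\<Lambda> x *v \<xi>) \<ge> lam_lo * (norm \<xi>)\<^sup>2 \<and>
         norm (\<Lambda> x *v \<xi>) \<le> lam_hi * norm \<xi>)"
    using cell[OF assms] by (auto elim: eventually_mono)
  then show ?thesis
    using cell_lebesgue[OF assms] by (simp add: AE_restrict_space_iff)
qed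

lemma cell_gradient_measurable:
  assumes K: "K \<in> cells D"
  shows "cell_gradient \<eta> D K v \<in> borel_measurable (lebesgue_on K)"
proof -
  have "pyramid D K \<sigma> \<in> sets lebesgue" if "\<sigma> \<in> faces_of D K" for \<sigma>
    using pyramid_borel[of \<sigma> D K] faces_open[OF K that] by simp
  then have "cell_gradient \<eta> D K v \<in> borel_measurable lebesgue"
    unfolding cell_gradient_def[abs_def]
    by (intro borel_measurable_sum borel_measurable_scaleR borel_measurable_indicator
        measurable_const) auto
  then show ?thesis by (rule measurable_restrict_space1)
qed

definition integrand ::
  "real \<Rightarrow> (real^'d) set \<Rightarrow> 'd dofs \<Rightarrow> 'd dofs \<Rightarrow> real^'d \<Rightarrow> real" where
  "integrand \<eta> K v w x = \<omega> x * ((\<Lambda> x *v cell_gradient \<eta> D K v x) \<bullet> cell_gradient \<eta> D K w x)"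

text \<open>
  On a cell the discrete gradients take finitely many values, so the integrand is bounded almost
  everywhere on a set of finite measure.
\<close>

lemma integrable_integrand:
  assumes K: "K \<in> cells D"
  shows "integrable (lebesgue_on K) (integrand \<eta> K v w)"
proof (rule finite_measure.integrable_const_bound[OF finite_measure_cell[OF K]])
  define B where "B z = (\<Sum>\<sigma>\<in>faces_of D K. norm (face_gradient \<eta> D K \<sigma> z))" for z
  have bound: "norm (integrand \<eta> K v w x) \<le> om_hi * (\<bar>lam_hi\<bar> * B v * B w)"
    if x: "x \<in> K" and \<Lambda>: "\<forall>\<xi>. norm (\<Lambda> x *v \<xi>) \<le> lam_hi * norm \<xi>" for x
  proof -
    let ?g = "cell_gradient \<eta> D K v x" and ?h = "cell_gradient \<eta> D K w x"
    have B: "norm ?g \<le> B v" "norm ?h \<le> B w"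
      unfolding B_def by (rule norm_cell_gradient_le)+
    have "norm (\<Lambda> x *v ?g) \<le> \<bar>lam_hi\<bar> * norm ?g"
      using \<Lambda> by (meson abs_ge_self mult_right_mono norm_ge_zero order_trans)
    also have "\<dots> \<le> \<bar>lam_hi\<bar> * B v"
      using B by (intro mult_left_mono) auto
    finally have "norm (\<Lambda> x *v ?g) * norm ?h \<le> \<bar>lam_hi\<bar> * B v * B w"
      using B(2) by (intro mult_mono) (auto simp: B_def sum_nonneg)
    then have "\<bar>(\<Lambda> x *v ?g) \<bullet> ?h\<bar> \<le> \<bar>lam_hi\<bar> * B v * B w"
      using Cauchy_Schwarz_ineq2 order_trans by blast
    then show ?thesis
      using cell_weight_bounds[OF K x] om_lo_pos
      unfolding integrand_def real_norm_def abs_mult by (intro mult_mono) auto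
  qed
  show "AE x in lebesgue_on K. norm (integrand \<eta> K v w x) \<le> om_hi * (\<bar>lam_hi\<bar> * B v * B w)"
    using diffusion_bounds_cell[OF K] AE_space by eventually_elim (rule bound, auto)
next
  note [measurable] = cell_gradient_measurable[OF K] diffusion_measurable_cell[OF K]
    weight_measurable_cell[OF K]
  have "(\<lambda>x. \<Lambda> x *v cell_gradient \<eta> D K v x) \<in> borel_measurable (lebesgue_on K)"
    using borel_measurable_continuous_on[OF continuous_matrix_vector_pair,
        of "\<lambda>x. (\<Lambda> x, cell_gradient \<eta> D K v x)" "lebesgue_on K"] by simp
  then show "integrand \<eta> K v w \<in> borel_measurable (lebesgue_on K)"
    unfolding integrand_def[abs_def] by simp
qed

lemma a_form_eq: "a_form \<eta> \<omega> \<Lambda> D v w = (\<Sum>K\<in>cells D. LINT x|lebesgue_on K. integrand \<eta> K v w x)"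
  by (simp add: a_form_def integrand_def)

lemma a_form_diff_left: "a_form \<eta> \<omega> \<Lambda> D (v - w) z = a_form \<eta> \<omega> \<Lambda> D v z - a_form \<eta> \<omega> \<Lambda> D w z"
proof -
  have "integrand \<eta> K (v - w) z x = integrand \<eta> K v z x - integrand \<eta> K w z x" for K x
    by (simp add: integrand_def cell_gradient_diff matrix_vector_mult_diff_distrib
        inner_diff_left right_diff_distrib)
  then show ?thesis
    by (simp add: a_form_eq integrable_integrand sum_subtractf)
qed

text \<open>
  The comparison of integrals holds for almost every point because the ellipticity bound on the
  diffusion does.
\<close>

lemma integrand_coercive:
  assumes K: "K \<in> cells D"
  shows "om_lo * lam_lo * (L2_norm (lebesgue_on K) (cell_gradient \<eta> D K v))\<^sup>2
    \<le> (LINT x|lebesgue_on K. integrand \<eta> K v v x)"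
proof -
  let ?g = "\<lambda>x. (norm (cell_gradient \<eta> D K v x))\<^sup>2"
  have "om_lo * lam_lo * (L2_norm (lebesgue_on K) (cell_gradient \<eta> D K v))\<^sup>2
      = (LINT x|lebesgue_on K. om_lo * lam_lo * ?g x)"
    by (simp add: L2_norm_def)
  also have "\<dots> \<le> (LINT x|lebesgue_on K. integrand \<eta> K v v x)"
  proof (rule integral_mono_AE')
    show "integrable (lebesgue_on K) (integrand \<eta> K v v)"
      by (rule integrable_integrand[OF K])
    show "AE x in lebesgue_on K. om_lo * lam_lo * ?g x \<le> integrand \<eta> K v v x"
      using diffusion_bounds_cell[OF K] AE_space
    proof eventually_elim
      case (elim x)
      then have "om_lo * (lam_lo * ?g x) \<le> integrand \<eta> K v v x"
        unfolding integrand_def using cell_weight_bounds[OF K, of x] om_lo_pos lam_lo_pos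
        by (intro mult_mono) (auto simp: inner_commute)
      then show ?case by (simp add: mult.assoc)
    qed
    show "AE x in lebesgue_on K. 0 \<le> integrand \<eta> K v v x"
      using diffusion_bounds_cell[OF K] AE_space
    proof eventually_elim
      case (elim x)
      have "0 \<le> lam_lo * ?g x" using lam_lo_pos by simp
      also have "\<dots> \<le> (\<Lambda> x *v cell_gradient \<eta> D K v x) \<bullet> cell_gradient \<eta> D K v x"
        using elim by (simp add: inner_commute)
      finally show ?case
        unfolding integrand_def using elim cell_weight_bounds[OF K, of x] om_lo_pos
        by (intro mult_nonneg_nonneg) auto
    qed
  qed
  finally show ?thesis .
qed

lemma a_form_coercive:
  assumes a: "\<And>K. K \<in> cells D \<Longrightarrow>
      a * local_seminorm_sq D K v \<le> (L2_norm (lebesgue_on K) (cell_gradient \<eta> D K v))\<^sup>2"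
  shows "om_lo * lam_lo * a * (seminorm D v)\<^sup>2 \<le> a_form \<eta> \<omega> \<Lambda> D v v"
proof -
  have "0 \<le> (\<Sum>K\<in>cells D. local_seminorm_sq D K v)"
    unfolding local_seminorm_sq_def
    by (intro sum_nonneg mult_nonneg_nonneg divide_nonneg_nonneg)
      (auto simp: area_def dist_face_def infdist_nonneg)
  then have "om_lo * lam_lo * a * (seminorm D v)\<^sup>2
      = (\<Sum>K\<in>cells D. om_lo * lam_lo * (a * local_seminorm_sq D K v))"
    by (simp add: seminorm_def sum_distrib_left mult.assoc)
  also have "\<dots> \<le> (\<Sum>K\<in>cells D. om_lo * lam_lo * (L2_norm (lebesgue_on K) (cell_gradient \<eta> D K v))\<^sup>2)"
    using a om_lo_pos lam_lo_pos by (intro sum_mono mult_left_mono) auto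
  also have "\<dots> \<le> a_form \<eta> \<omega> \<Lambda> D v v"
    unfolding a_form_eq by (intro sum_mono integrand_coercive)
  finally show ?thesis .
qed

text \<open>
  Test both schemes with \<open>\<rho> (n + 1) - \<rho>inf\<close> and subtract. Only the cell values of the previous
  iterate enter, so the initial vector, whose face values are arbitrary, is covered as well.
\<close>

lemma energy_dissipation:
  assumes evolution: "evolution_solution \<Omega> \<Gamma>D \<Gamma>N \<eta> \<omega> \<Lambda> f gN uin dt D \<rho>"
    and stationary: "stationary_solution \<Omega> \<Gamma>D \<Gamma>N \<eta> \<omega> \<Lambda> f gN D \<rho>inf"
    and dt: "0 < dt"
  shows "(energy \<Omega> \<omega> D \<rho> \<rho>inf (n + 1) - energy \<Omega> \<omega> D \<rho> \<rho>inf n) / dt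
      + dissipation \<eta> \<omega> \<Lambda> D \<rho> \<rho>inf (n + 1) \<le> 0"
proof -
  define v where "v = \<rho> (n + 1) - \<rho>inf"
  define w where "w = \<rho> n - \<rho>inf"
  define S where "S = (\<Sum>K\<in>cells D. mass K * ((fst v K - fst w K) * fst v K))"
  have mem: "\<rho> (n + 1) \<in> V_omega \<Omega> \<Gamma>D \<omega> D" "\<rho>inf \<in> V_omega \<Omega> \<Gamma>D \<omega> D"
    using evolution stationary by (auto simp: evolution_solution_def stationary_solution_def)
  then have v: "v \<in> V_omega \<Omega> \<Gamma>D \<omega> D"
    unfolding v_def by (rule V_omega_diff)
  have "1 / dt * L2_inner (lebesgue_on \<Omega>)
            (\<lambda>x. cell_fun D (\<rho> (n + 1)) x - cell_fun D (\<rho> n) x)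
            (\<lambda>x. cell_fun D (means \<omega>) x * cell_fun D v x)
          + a_form \<eta> \<omega> \<Lambda> D (\<rho> (n + 1)) v = load \<Omega> \<Gamma>N f gN D v"
    using evolution v by (force simp: evolution_solution_def dest!: spec[of _ "n + 1"])
  moreover have "a_form \<eta> \<omega> \<Lambda> D \<rho>inf v = load \<Omega> \<Gamma>N f gN D v"
    using stationary v by (simp add: stationary_solution_def)
  \<comment> \<open>The increments of \<open>\<rho>\<close> and of \<open>\<rho> - \<rho>inf\<close> agree, so \<open>S\<close> is the accumulation term.\<close>
  ultimately have balance: "S / dt + a_form \<eta> \<omega> \<Lambda> D v v = 0"
    unfolding L2_inner_increment_means by (simp add: a_form_diff_left v_def w_def S_def)
  have "1/2 * weighted_sq v - 1/2 * weighted_sq w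
      = (\<Sum>K\<in>cells D. mass K * (1/2 * (fst v K)\<^sup>2 - 1/2 * (fst w K)\<^sup>2))"
    by (simp add: weighted_sq_def sum_distrib_left sum_subtractf right_diff_distrib mult_ac)
  also have "\<dots> \<le> S"
    unfolding S_def
  proof (intro sum_mono mult_left_mono less_imp_le[OF mass_pos])
    fix K
    have "0 \<le> (fst v K - fst w K)\<^sup>2" by simp
    then show "1/2 * (fst v K)\<^sup>2 - 1/2 * (fst w K)\<^sup>2 \<le> (fst v K - fst w K) * fst v K"
      by (simp add: power2_eq_square algebra_simps)
  qed
  finally have "(1/2 * weighted_sq v - 1/2 * weighted_sq w) / dt \<le> S / dt"
    using dt by (simp add: divide_right_mono)
  then show ?thesis
    using balance unfolding energy_eq dissipation_def v_def w_def by linarith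
qed

end

section \<open>Exponential decay\<close>

lemma relaxation_step:
  fixes e e' d \<nu> dt :: real
  assumes "0 < dt" "0 < \<nu>" and "(e' - e) / dt + d \<le> 0" and "\<nu> * e' \<le> d"
  shows "e' \<le> inverse (1 + \<nu> * dt) * e"
proof -
  have "e' - e + d * dt \<le> 0"
    using assms(1,3) mult_right_mono[OF assms(3), of dt] by (simp add: distrib_right)
  moreover have "\<nu> * e' * dt \<le> d * dt"
    using assms by (simp add: mult_right_mono)
  ultimately have "e' * (1 + \<nu> * dt) \<le> e" by (simp add: algebra_simps)
  moreover have "0 < 1 + \<nu> * dt" using assms by (simp add: add_pos_pos)
  ultimately show ?thesis by (simp add: field_simps)
qed

lemma geometric_decay:
  fixes e :: "nat \<Rightarrow> real"
  assumes "0 \<le> q" and "\<And>n. e (n + 1) \<le> q * e n"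
  shows "e n \<le> q ^ n * e 0"
proof (induction n)
  case (Suc n)
  have "e (Suc n) \<le> q * e n" using assms(2)[of n] by simp
  also have "\<dots> \<le> q * (q ^ n * e 0)" using Suc assms(1) by (rule mult_left_mono)
  finally show ?case by (simp add: mult.assoc)
qed simp

theorem theorem3:
  fixes \<Omega> \<Gamma>D \<Gamma>N :: "(real^'d::finite) set"
    and \<Lambda> :: "real^'d \<Rightarrow> real^'d^'d"
    and \<phi> \<omega> f gN uin :: "real^'d \<Rightarrow> real"
    and lam_lo lam_hi om_lo om_hi dt \<eta> C_P \<nu> :: real
    and \<alpha> C_PW C_PD :: "real \<Rightarrow> real"
    and D :: "'d mesh"
    and \<rho> u :: "nat \<Rightarrow> 'd dofs" and \<rho>inf uinf :: "'d dofs"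
  assumes dim: "CARD('d) \<in> {2, 3}"
    and domain: "open \<Omega>" "bounded \<Omega>" "connected \<Omega>" "polytopal \<Omega>"
    and boundary: "frontier \<Omega> = closure \<Gamma>D \<union> closure \<Gamma>N" "disjnt \<Gamma>D \<Gamma>N"
      "openin (top_of_set (frontier \<Omega>)) \<Gamma>D" "openin (top_of_set (frontier \<Omega>)) \<Gamma>N"
    and diffusion: "Linf (lebesgue_on \<Omega>) \<Lambda>" "0 < lam_lo" "lam_lo \<le> lam_hi"
      "AE x in lebesgue_on \<Omega>. transpose (\<Lambda> x) = \<Lambda> x"
      "AE x in lebesgue_on \<Omega>. \<forall>\<xi>. \<xi> \<bullet> (\<Lambda> x *v \<xi>) \<ge> lam_lo * (norm \<xi>)\<^sup>2 \<and>
         norm (\<Lambda> x *v \<xi>) \<le> lam_hi * norm \<xi>"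
    and potential: "C1_closure \<Omega> \<phi>" "Hdiv \<Omega> (\<lambda>x. \<Lambda> x *v gradient \<phi> x)"
    and weight: "\<omega> = (\<lambda>x. exp (- \<phi> x))" "0 < om_lo" "om_lo \<le> om_hi"
      "\<forall>x\<in>closure \<Omega>. om_lo \<le> \<omega> x \<and> \<omega> x \<le> om_hi"
    and data: "L2 (lebesgue_on \<Omega>) f" "L2 (restrict_space surface \<Gamma>N) gN" "L2 (lebesgue_on \<Omega>) uin"
    and compat: "emeasure surface \<Gamma>D = 0 \<Longrightarrow>
         (LINT x|lebesgue_on \<Omega>. f x) + (LINT x|restrict_space surface \<Gamma>N. gN x) = 0 \<and>
         (LINT x|lebesgue_on \<Omega>. uin x) = 0"
    and discr: "0 < dt" "0 < \<eta>" "discretisation \<Omega> \<Gamma>D \<Gamma>N D"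
    and coercivity: "0 < \<alpha> (theta D)"
      "\<forall>K\<in>cells D. \<forall>v. \<alpha> (theta D) * local_seminorm_sq D K v \<le>
         (L2_norm (lebesgue_on K) (cell_gradient \<eta> D K v))\<^sup>2"
    and poincare_wirtinger: "0 < C_PW (theta D)"
      "\<forall>v\<in>V_neumann \<Omega> D. L2_norm (lebesgue_on \<Omega>) (cell_fun D v) \<le> C_PW (theta D) * seminorm D v"
    and poincare: "emeasure surface \<Gamma>D > 0 \<Longrightarrow> 0 < C_PD (theta D) \<and>
      (\<forall>v\<in>V_dirichlet \<Omega> \<Gamma>D D.
         L2_norm (lebesgue_on \<Omega>) (cell_fun D v) \<le> C_PD (theta D) * seminorm D v)"
    and schemes: "evolution_solution \<Omega> \<Gamma>D \<Gamma>N \<eta> \<omega> \<Lambda> f gN uin dt D \<rho>"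
      "stationary_solution \<Omega> \<Gamma>D \<Gamma>N \<eta> \<omega> \<Lambda> f gN D \<rho>inf"
    and densities: "u = (\<lambda>n. dofs_mult (means \<omega>) (\<rho> n))" "uinf = dofs_mult (means \<omega>) \<rho>inf"
    and constants: "C_P = (if emeasure surface \<Gamma>D = 0 then 2 * C_PW (theta D) else C_PD (theta D))"
      "\<nu> = 2 * om_lo * lam_lo * \<alpha> (theta D) / (om_hi * C_P\<^sup>2)"
  shows "(\<forall>n. (energy \<Omega> \<omega> D \<rho> \<rho>inf (n + 1) - energy \<Omega> \<omega> D \<rho> \<rho>inf n) / dt
             + dissipation \<eta> \<omega> \<Lambda> D \<rho> \<rho>inf (n + 1) \<le> 0) \<and>
         0 < \<nu> \<and>
         (\<forall>n. energy \<Omega> \<omega> D \<rho> \<rho>inf (n + 1) \<le> inverse (1 + \<nu> * dt) * energy \<Omega> \<omega> D \<rho> \<rho>inf n) \<and>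
         (\<forall>n\<ge>1. L2_norm (lebesgue_on \<Omega>) (\<lambda>x. cell_fun D (u n) x - cell_fun D uinf x)
             \<le> sqrt (om_hi / om_lo) * (1 + \<nu> * dt) powr (- (real n / 2)) *
               L2_norm (lebesgue_on \<Omega>) (\<lambda>x. cell_fun D (u 0) x - cell_fun D uinf x))"
proof -
  let ?a = "\<alpha> (theta D)"
  interpret diffusion_mesh \<Omega> D \<omega> om_lo om_hi \<Lambda> lam_lo lam_hi
  proof
    show "continuous_on \<Omega> \<omega>"
      using potential(1) unfolding weight(1) C1_closure_def
      by (auto intro!: continuous_intros elim: continuous_on_subset[OF _ closure_subset])
    show "om_lo \<le> \<omega> x \<and> \<omega> x \<le> om_hi" if "x \<in> \<Omega>" for x
      using weight(4) closure_subset that by blast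
    show "\<Lambda> \<in> borel_measurable (lebesgue_on \<Omega>)"
      using diffusion(1) by (simp add: Linf_def)
    show "openin (top_of_set (affine hull \<sigma>)) \<sigma> \<and> 0 < dist_face D K \<sigma>"
      if "K \<in> cells D" "\<sigma> \<in> faces_of D K" for K \<sigma>
      using discr(3) that by (rule discretisation_faces)
    show "open K \<and> K \<subseteq> \<Omega> \<and> 0 < vol K" if "K \<in> cells D" for K
      using discr(3) that by (rule discretisation_cells)
  qed (use domain diffusion(2,5) weight(2) discretisation_cells[OF discr(3)] in simp_all)

  have "0 < C_P"
    using constants(1) poincare_wirtinger(1) poincare by (auto simp: zero_less_iff_neq_zero)
  have "0 < om_hi" using weight(2,3) by simp
  have \<nu>: "0 < \<nu>"
    using constants(2) \<open>0 < C_P\<close> \<open>0 < om_hi\<close> weight(2) diffusion(2) coercivity(1) by simp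
  have step: "(energy \<Omega> \<omega> D \<rho> \<rho>inf (n + 1) - energy \<Omega> \<omega> D \<rho> \<rho>inf n) / dt
      + dissipation \<eta> \<omega> \<Lambda> D \<rho> \<rho>inf (n + 1) \<le> 0" for n
    by (rule energy_dissipation[OF schemes discr(1)])

  \<comment> \<open>Both boundary configurations lead to a Poincare inequality in the weighted norm with constant \<open>C_P\<close>.\<close>
  have poincare_weighted: "weighted_sq v \<le> om_hi * (C_P * seminorm D v)\<^sup>2"
    if v: "v \<in> V_omega \<Omega> \<Gamma>D \<omega> D" for v
  proof (cases "emeasure surface \<Gamma>D = 0")
    case True
    then have "(\<Sum>K\<in>cells D. mass K * fst v K) = 0"
      using v by (simp add: V_omega_def integral_weight_cell_fun)
    then have "weighted_sq v \<le> om_hi * (C_PW (theta D) * seminorm D v)\<^sup>2"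
      using poincare_wirtinger by (intro weighted_poincare_wirtinger) auto
    also have "(C_PW (theta D) * seminorm D v)\<^sup>2 \<le> (C_P * seminorm D v)\<^sup>2"
      unfolding power_mult_distrib using True constants(1) poincare_wirtinger(1)
      by (intro mult_right_mono power_mono) auto
    finally show ?thesis using \<open>0 < om_hi\<close> by simp
  next
    case False
    then have pos: "0 < emeasure surface \<Gamma>D" by (simp add: zero_less_iff_neq_zero)
    then have "L2_norm (lebesgue_on \<Omega>) (cell_fun D v) \<le> C_P * seminorm D v"
      using False v poincare constants(1) by (simp add: V_omega_def)
    then have "(L2_norm (lebesgue_on \<Omega>) (cell_fun D v))\<^sup>2 \<le> (C_P * seminorm D v)\<^sup>2"
      by (intro power_mono) (simp_all add: L2_norm_def)
    then have "plain_sq v \<le> (C_P * seminorm D v)\<^sup>2"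
      by (simp only: L2_norm_cell_fun_sq)
    then have "om_hi * plain_sq v \<le> om_hi * (C_P * seminorm D v)\<^sup>2"
      using \<open>0 < om_hi\<close> by simp
    then show ?thesis using weighted_sq_le[of v] by linarith
  qed

  have coercive: "\<nu> * energy \<Omega> \<omega> D \<rho> \<rho>inf (n + 1) \<le> dissipation \<eta> \<omega> \<Lambda> D \<rho> \<rho>inf (n + 1)" for n
  proof -
    define v where "v = \<rho> (n + 1) - \<rho>inf"
    have "\<rho> (n + 1) \<in> V_omega \<Omega> \<Gamma>D \<omega> D" "\<rho>inf \<in> V_omega \<Omega> \<Gamma>D \<omega> D"
      using schemes by (auto simp: evolution_solution_def stationary_solution_def)
    then have "v \<in> V_omega \<Omega> \<Gamma>D \<omega> D"
      unfolding v_def by (rule V_omega_diff)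
    then have "\<nu> * (1/2 * weighted_sq v) \<le> \<nu> * (1/2 * (om_hi * (C_P * seminorm D v)\<^sup>2))"
      using poincare_weighted \<nu> by simp
    \<comment> \<open>The rate \<open>\<nu>\<close> is exactly the one for which the Poincare constant cancels here.\<close>
    also have "\<dots> = om_lo * lam_lo * ?a * (seminorm D v)\<^sup>2"
      using \<open>0 < C_P\<close> \<open>0 < om_hi\<close> by (simp add: constants(2) power_mult_distrib)
    also have "\<dots> \<le> a_form \<eta> \<omega> \<Lambda> D v v"
      using coercivity(2) by (intro a_form_coercive) blast
    finally show ?thesis
      unfolding energy_eq dissipation_def v_def .
  qed
  have contract: "energy \<Omega> \<omega> D \<rho> \<rho>inf (n + 1) \<le> inverse (1 + \<nu> * dt) * energy \<Omega> \<omega> D \<rho> \<rho>inf n" for n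
    using discr(1) \<nu> step coercive by (rule relaxation_step)

  have decay: "L2_norm (lebesgue_on \<Omega>) (\<lambda>x. cell_fun D (u n) x - cell_fun D uinf x)
      \<le> sqrt (om_hi / om_lo) * (1 + \<nu> * dt) powr (- (real n / 2)) *
        L2_norm (lebesgue_on \<Omega>) (\<lambda>x. cell_fun D (u 0) x - cell_fun D uinf x)" for n
  proof -
    define N where "N n = L2_norm (lebesgue_on \<Omega>) (\<lambda>x. cell_fun D (u n) x - cell_fun D uinf x)" for n
    define W where "W n = weighted_sq (\<rho> n - \<rho>inf)" for n
    define q where "q = inverse (1 + \<nu> * dt)"
    have base: "0 < 1 + \<nu> * dt" using \<nu> discr(1) by (simp add: add_pos_pos)
    then have "0 \<le> q" by (simp add: q_def)
    have N0: "0 \<le> N k" for k by (simp add: N_def L2_norm_def)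
    have NW: "om_lo * W k \<le> (N k)\<^sup>2" "(N k)\<^sup>2 \<le> om_hi * W k" for k
      unfolding N_def W_def densities by (rule L2_norm_density_diff_bounds)+
    have "W n \<le> q ^ n * W 0"
      using \<open>0 \<le> q\<close> contract by (intro geometric_decay) (simp_all add: energy_eq W_def q_def)
    have "(N n)\<^sup>2 \<le> om_hi * W n" by (rule NW)
    also have "\<dots> \<le> om_hi * (q ^ n * W 0)"
      using \<open>W n \<le> _\<close> \<open>0 < om_hi\<close> by simp
    also have "W 0 \<le> (N 0)\<^sup>2 / om_lo"
      using NW(1)[of 0] weight(2) by (simp add: pos_le_divide_eq mult.commute)
    finally have "(N n)\<^sup>2 \<le> om_hi * (q ^ n * ((N 0)\<^sup>2 / om_lo))"
      using \<open>0 < om_hi\<close> \<open>0 \<le> q\<close> by (simp add: mult_left_mono)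
    also have "\<dots> = (sqrt (om_hi / om_lo) * (1 + \<nu> * dt) powr (- (real n / 2)) * N 0)\<^sup>2"
    proof -
      have "((1 + \<nu> * dt) powr (- (real n / 2)))\<^sup>2 = (1 + \<nu> * dt) powr (- real n)"
        by (simp add: power2_eq_square powr_add[symmetric])
      also have "\<dots> = q ^ n"
        using base by (simp add: q_def powr_minus powr_realpow power_inverse)
      finally show ?thesis
        using \<open>0 < om_hi\<close> weight(2) by (simp add: power_mult_distrib)
    qed
    finally show ?thesis
      unfolding N_def[symmetric]
      by (rule power2_le_imp_le) (use N0 in \<open>simp add: \<open>0 < om_hi\<close> weight(2) less_imp_le\<close>)
  qed
  show ?thesis using step \<nu> contract decay by blast
qed

end
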